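(* Let $a\in\mathbb{R}$, $a\neq 0$. Let $\Sigma$ be a timelike intrinsic rotational surface of $\mathbf{E}_1^3$, with coordinates $(u,v)$ in which $\mathrm{I}=\rho(u)^2(du^2-dv^2)$, with zero mean curvature, twist $\alpha(v)=av$, and no open sets of umbilic points. Then there are constants $A,B>0$ such that, up to an isometry and a homothety of $\mathbf{E}_1^3$, $\Sigma$ is parametrized by the following map $X(u,v)$. (1) If $B\neq\pm 2a$: $$X(u,v)=\left(\begin{array}{c} \frac{e^{2au}\cosh(2av)}{2aB}\\ \frac{e^{(2a-B)u}\left((2a+B)\cosh((2a-B)v)-A^2(2a-B)e^{2Bu}\cosh((2a+B)v)\right)}{2AB(4a^2-B^2)}\\ -\frac{e^{(2a-B)u}\left(A^2(2a-B)e^{2Bu}\sinh((2a+B)v)+(2a+B)\sinh((2a-B)v)\right)}{2AB(4a^2-B^2)} \end{array}\right),$$ with first fundamental form $\mathrm{I}=\frac{e^{(4a-2B)u}(A^2e^{2Bu}+1)^2}{4A^2B^2}(du^2-dv^2)$. (2) If $B=2a$: $$X(u,v)=\left(\frac{e^{2au}\cosh(2av)}{4a^2},\ \frac{4au-A^2e^{4au}\cosh(4av)}{16a^2A},\ -\frac{A^2e^{4au}\sinh(4av)+4av}{16a^2A}\right),$$ with $\mathrm{I}=\frac{(A^2e^{4au}+1)^2}{16a^2A^2}(du^2-dv^2)$. (3) If $B=-2a$: $$X(u,v)=\left(-\frac{e^{2au}\cosh(2av)}{4a^2},\ \frac{4aA^2u-e^{4au}\cosh(4av)}{16a^2A},\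 \frac{4aA^2v+e^{4au}\sinh(4av)}{16a^2A}\right),$$ with $\mathrm{I}=\frac{(A^2+e^{4au})^2}{16a^2A^2}(du^2-dv^2)$. In all cases, the domain of $X$ is $\mathbb{R}^2$.
   Context: $\mathbf{E}_1^3$ is $\mathbb{R}^3$ with the Lorentzian metric $\langle,\rangle=dx_1^2+dx_2^2-dx_3^2$. A surface is timelike if its induced metric is Lorentzian. A timelike surface $\Sigma$ is an intrinsic rotational surface if it has local coordinates $(u,v)$, ranging over a product of open intervals, in which the first fundamental form is $\mathrm{I}=\rho(u)^2(\delta\,du^2+\epsilon\,dv^2)$ with $\delta=-\epsilon\in\{-1,1\}$ and $\rho>0$ a smooth function of $u$ only; here $\delta=1$, $\epsilon=-1$. Let $N$ be a unit (spacelike) normal field. The Weingarten endomorphism is $AX=-(\nabla^0_XN)^\top$, with $\nabla^0$ the Levi-Civita connection of $\mathbf{E}_1^3$. When it is (real) diagonalizable, its eigenvalues $\lambda_1,\lambda_2$ are the principal curvatures; the mean curvature is $H=\frac{\lambda_1+\lambda_2}{2}$; a point is umbilic if $\lambda_1=\lambda_2$ there. (In the claim the letter $A$ denotes a positive constant, not the endomorphism.) $\Sigma$ has twist $\alpha$, for a smooth function $\alpha$ of $v$, if the Weingarten endomorphism is diagonalizable and its matrix with respect to $\{\partial_u,\partial_v\}$ is $G_{-\alpha(v)}\,\mathrm{diag}(\lambda_1(u),\lambda_2(u))\,G_{\alpha(v)}$, where $\lambda_1,\lambda_2$ depend only on $u$ and $G_\theta=\begin{pmatrix}\cosh\theta&\sinh\theta\\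 \sinh\theta&\cosh\theta\end{pmatrix}$. "Parametrized by $X$" means that $\Sigma$ is the image of $X$ restricted to the range of the coordinates $(u,v)$; the stated domain of $X$ is the set where $X$ is an immersion. *)

theory Defs
  imports "HOL-Analysis.Analysis"
begin

primrec Ck_on :: "nat \<Rightarrow> 'a::euclidean_space set \<Rightarrow> ('a \<Rightarrow> 'b::real_normed_vector) \<Rightarrow> bool" where
  "Ck_on 0 S f \<longleftrightarrow> continuous_on S f"
| "Ck_on (Suc k) S f \<longleftrightarrow>
     (\<forall>x\<in>S. f differentiable (at x)) \<and>
     (\<forall>v. Ck_on k S (\<lambda>x. frechet_derivative f (at x) v))"

(* Derivatives are taken in the ambient space, so this is meant for open S only. *)
definition smooth_on :: "'a::euclidean_space set \<Rightarrow> ('a \<Rightarrow> 'b::real_normed_vector) \<Rightarrow> bool" where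
  "smooth_on S f \<longleftrightarrow> (\<forall>k. Ck_on k S f)"

definition lorentz :: "real^3 \<Rightarrow> real^3 \<Rightarrow> real" where
  "lorentz x y = x$1 * y$1 + x$2 * y$2 - x$3 * y$3"

definition lorentz_isometry :: "(real^3 \<Rightarrow> real^3) \<Rightarrow> bool" where
  "lorentz_isometry \<phi> \<longleftrightarrow>
     (\<exists>L b. linear L \<and> (\<forall>x y. lorentz (L x) (L y) = lorentz x y) \<and> \<phi> = (\<lambda>x. L x + b))"

definition homothety :: "(real^3 \<Rightarrow> real^3) \<Rightarrow> bool" where
  "homothety h \<longleftrightarrow> (\<exists>c s. s \<noteq> 0 \<and> h = (\<lambda>x. c + s *\<^sub>R (x - c)))"

text \<open>
  A parametrized surface is a map \<open>f\<close> from (an open subset of) the \<open>(u, v)\<close>-plane to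
  \<open>real^3\<close>. Tangent vectors at \<open>p\<close> are written as \<open>tangent_map f p x\<close> with \<open>x\<close> in the plane, so
  \<open>tangent_map f p (1, 0)\<close> and \<open>tangent_map f p (0, 1)\<close> are the coordinate fields.
  Self-intersections are allowed, as for immersed surfaces in general.
\<close>

definition tangent_map :: "(real \<times> real \<Rightarrow> real^3) \<Rightarrow> real \<times> real \<Rightarrow> real \<times> real \<Rightarrow> real^3" where
  "tangent_map f p = frechet_derivative f (at p)"

definition immersion_at :: "(real \<times> real \<Rightarrow> real^3) \<Rightarrow> real \<times> real \<Rightarrow> bool" where
  "immersion_at f p \<longleftrightarrow> f differentiable (at p) \<and> inj (tangent_map f p)"

definition first_form ::
  "(real \<times> real \<Rightarrow> real^3) \<Rightarrow> real \<times> real \<Rightarrow> real \<times> real \<Rightarrow> real \<times> real \<Rightarrow> real" where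
  "first_form f p x y = lorentz (tangent_map f p x) (tangent_map f p y)"

definition timelike_surface :: "(real \<times> real \<Rightarrow> real^3) \<Rightarrow> (real \<times> real) set \<Rightarrow> bool" where
  "timelike_surface f S \<longleftrightarrow> open S \<and> smooth_on S f \<and>
     (\<forall>p\<in>S. immersion_at f p \<and>
        (\<exists>x y. first_form f p x x = 1 \<and> first_form f p y y = -1 \<and> first_form f p x y = 0))"

text \<open>On \<open>S\<close>, the first fundamental form of \<open>f\<close> is \<open>\<mu>(u,v) (\<delta> du\<^sup>2 + \<epsilon> dv\<^sup>2)\<close>.\<close>

definition has_first_form ::
  "(real \<times> real \<Rightarrow> real^3) \<Rightarrow> (real \<times> real) set \<Rightarrow> real \<Rightarrow> real \<Rightarrow> (real \<Rightarrow> real \<Rightarrow> real) \<Rightarrow> bool" where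
  "has_first_form f S \<delta> \<epsilon> \<mu> \<longleftrightarrow>
     (\<forall>(u, v)\<in>S. \<forall>x y.
        first_form f (u, v) x y = \<mu> u v * (\<delta> * (fst x * fst y) + \<epsilon> * (snd x * snd y)))"

definition intrinsic_rotational ::
  "real \<Rightarrow> real \<Rightarrow> (real \<Rightarrow> real) \<Rightarrow> (real \<times> real \<Rightarrow> real^3) \<Rightarrow> real set \<Rightarrow> real set \<Rightarrow> bool" where
  "intrinsic_rotational \<delta> \<epsilon> \<rho> f I J \<longleftrightarrow>
     \<delta> = - \<epsilon> \<and> \<delta> \<in> {-1, 1} \<and>
     open I \<and> is_interval I \<and> I \<noteq> {} \<and> open J \<and> is_interval J \<and> J \<noteq> {} \<and>
     timelike_surface f (I \<times> J) \<and>
     smooth_on I \<rho> \<and> (\<forall>u\<in>I. \<rho> u > 0) \<and>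
     has_first_form f (I \<times> J) \<delta> \<epsilon> (\<lambda>u v. (\<rho> u)\<^sup>2)"

definition unit_normal_field ::
  "(real \<times> real \<Rightarrow> real^3) \<Rightarrow> (real \<times> real) set \<Rightarrow> (real \<times> real \<Rightarrow> real^3) \<Rightarrow> bool" where
  "unit_normal_field f S N \<longleftrightarrow> smooth_on S N \<and>
     (\<forall>p\<in>S. lorentz (N p) (N p) = 1 \<and> (\<forall>x. lorentz (N p) (tangent_map f p x) = 0))"

definition tangential_part :: "(real \<times> real \<Rightarrow> real^3) \<Rightarrow> real \<times> real \<Rightarrow> real^3 \<Rightarrow> real^3" where
  "tangential_part f p w =
     (THE t. t \<in> range (tangent_map f p) \<and> (\<forall>x. lorentz (w - t) (tangent_map f p x) = 0))"

text \<open>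
  The Weingarten endomorphism applied to the tangent vector \<open>tangent_map f p x\<close>. The
  Levi-Civita connection of the flat ambient space is the ordinary derivative.
\<close>

definition weingarten ::
  "(real \<times> real \<Rightarrow> real^3) \<Rightarrow> (real \<times> real \<Rightarrow> real^3) \<Rightarrow> real \<times> real \<Rightarrow> real \<times> real \<Rightarrow> real^3" where
  "weingarten f N p x = - tangential_part f p (frechet_derivative N (at p) x)"

text \<open>
  The Weingarten endomorphism at \<open>p\<close> is diagonalizable with eigenvalues \<open>l1\<close>, \<open>l2\<close>; the
  eigenbasis of the tangent plane is the image of \<open>e1\<close>, \<open>e2\<close>.
\<close>

definition principal_curvatures ::
  "(real \<times> real \<Rightarrow> real^3) \<Rightarrow> (real \<times> real \<Rightarrow> real^3) \<Rightarrow> real \<times> real \<Rightarrow> real \<Rightarrow> real \<Rightarrow> bool" where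
  "principal_curvatures f N p l1 l2 \<longleftrightarrow>
     (\<exists>e1 e2. e1 \<noteq> e2 \<and> independent {e1, e2} \<and>
        weingarten f N p e1 = l1 *\<^sub>R tangent_map f p e1 \<and>
        weingarten f N p e2 = l2 *\<^sub>R tangent_map f p e2)"

definition mean_curvature ::
  "(real \<times> real \<Rightarrow> real^3) \<Rightarrow> (real \<times> real \<Rightarrow> real^3) \<Rightarrow> real \<times> real \<Rightarrow> real" where
  "mean_curvature f N p = (THE H. \<exists>l1 l2. principal_curvatures f N p l1 l2 \<and> H = (l1 + l2) / 2)"

definition umbilic ::
  "(real \<times> real \<Rightarrow> real^3) \<Rightarrow> (real \<times> real \<Rightarrow> real^3) \<Rightarrow> real \<times> real \<Rightarrow> bool" where
  "umbilic f N p \<longleftrightarrow> (\<exists>l. principal_curvatures f N p l l)"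

text \<open>Columns of the matrix are the coordinates of the images of the basis vectors.\<close>

definition weingarten_matrix ::
  "(real \<times> real \<Rightarrow> real^3) \<Rightarrow> (real \<times> real \<Rightarrow> real^3) \<Rightarrow> real \<times> real \<Rightarrow> real^2^2 \<Rightarrow> bool" where
  "weingarten_matrix f N p M \<longleftrightarrow>
     weingarten f N p (1, 0) =
       M$1$1 *\<^sub>R tangent_map f p (1, 0) + M$2$1 *\<^sub>R tangent_map f p (0, 1) \<and>
     weingarten f N p (0, 1) =
       M$1$2 *\<^sub>R tangent_map f p (1, 0) + M$2$2 *\<^sub>R tangent_map f p (0, 1)"

definition boost :: "real \<Rightarrow> real^2^2" where
  "boost \<theta> = vector [vector [cosh \<theta>, sinh \<theta>], vector [sinh \<theta>, cosh \<theta>]]"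

definition diag2 :: "real \<Rightarrow> real \<Rightarrow> real^2^2" where
  "diag2 l1 l2 = vector [vector [l1, 0], vector [0, l2]]"

definition has_twist ::
  "(real \<times> real \<Rightarrow> real^3) \<Rightarrow> (real \<times> real \<Rightarrow> real^3) \<Rightarrow> real set \<Rightarrow> real set \<Rightarrow> (real \<Rightarrow> real) \<Rightarrow> bool" where
  "has_twist f N I J \<alpha> \<longleftrightarrow> smooth_on J \<alpha> \<and>
     (\<forall>p\<in>I \<times> J. \<exists>l1 l2. principal_curvatures f N p l1 l2) \<and>
     (\<exists>l1 l2. \<forall>u\<in>I. \<forall>v\<in>J. weingarten_matrix f N (u, v)
        (boost (- \<alpha> v) ** diag2 (l1 u) (l2 u) ** boost (\<alpha> v)))"

definition parametrized_up_to_similarity ::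
  "(real^3) set \<Rightarrow> (real \<times> real \<Rightarrow> real^3) \<Rightarrow> (real \<times> real) set \<Rightarrow> bool" where
  "parametrized_up_to_similarity \<Sigma> X S \<longleftrightarrow>
     (\<exists>\<phi> h. lorentz_isometry \<phi> \<and> homothety h \<and> (h \<circ> \<phi>) ` \<Sigma> = X ` S)"

end

theory Submission
  imports Defs
begin

text \<open>
  The twist condition together with zero mean curvature fixes the second fundamental form up to one
  function: in the coordinates \<open>u\<close>, \<open>v\<close> its matrix is \<open>\<mu>(u)\<close> times the boost matrix of angle
  \<open>2 a v\<close>, where \<open>\<mu> = \<lambda> \<rho>\<^sup>2\<close> and \<open>\<lambda>\<close>, \<open>- \<lambda>\<close> are the principal curvatures. The integrability
  conditions of the surface then become two ordinary differential equations. The Codazzi equation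
  is \<open>\<mu>' = 2 a \<mu>\<close>, so \<open>\<mu> = m exp (2 a u)\<close> (\<open>codazzi_equation\<close>), and \<open>m \<noteq> 0\<close> because the surface
  is not umbilic everywhere. The Gauss equation is \<open>\<rho> \<rho>'' - \<rho>'\<^sup>2 = \<mu>\<^sup>2\<close> (\<open>gauss_equation\<close>). For
  \<open>y = \<rho> exp (- 2 a u) / \<bar>m\<bar>\<close> it reads \<open>y y'' - y'\<^sup>2 = 1\<close>, and the positive solutions of this
  equation on an interval are \<open>y = cosh (B u + ln A) / B\<close> with \<open>A, B > 0\<close>
  (\<open>liouville_ode_solution\<close>).
  
  A homothety of ratio \<open>1 / m\<close> normalizes \<open>m\<close> to \<open>1\<close>. Both fundamental forms of the scaled surface
  are then explicit functions of \<open>a\<close>, \<open>A\<close>, \<open>B\<close>. The surface \<open>model a A B\<close> carries an explicit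
  orthonormal frame with exactly these forms (\<open>adapted_frame_model\<close>). By the uniqueness part of
  Bonnet's theorem (\<open>adapted_frame_rigidity\<close>) the two surfaces differ by an isometry, which is the
  content of \<open>similar_to_model\<close>.
  
  The three cases are one surface: its coordinates are primitives of exponentials with exponents
  \<open>2 a\<close>, \<open>2 a - B\<close> and \<open>2 a + B\<close>, and a primitive is linear when its exponent vanishes.
\<close>

section \<open>Partial derivatives and the symmetry of second derivatives\<close>

text \<open>
  The two partial derivatives of a map on the plane. They are total functions; the values are
  meaningful where the map is differentiable.
\<close>

definition Du :: "(real \<times> real \<Rightarrow> 'b::real_normed_vector) \<Rightarrow> real \<times> real \<Rightarrow> 'b" where
  "Du f p = frechet_derivative f (at p) (1, 0)"

definition Dv :: "(real \<times> real \<Rightarrow> 'b::real_normed_vector) \<Rightarrow> real \<times> real \<Rightarrow> 'b" where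
  "Dv f p = frechet_derivative f (at p) (0, 1)"

lemma linear_pair_expand:
  fixes D :: "real \<times> real \<Rightarrow> 'b::real_vector"
  assumes "linear D"
  shows "D h = fst h *\<^sub>R D (1, 0) + snd h *\<^sub>R D (0, 1)"
proof -
  have "D h = D (fst h *\<^sub>R (1, 0) + snd h *\<^sub>R (0, 1))"
    by (rule arg_cong[of _ _ D]) (simp add: prod_eq_iff)
  also have "\<dots> = fst h *\<^sub>R D (1, 0) + snd h *\<^sub>R D (0, 1)"
    using assms by (simp only: linear_add linear_scale)
  finally show ?thesis .
qed

lemma Du_Dv_eqI:
  assumes "(f has_derivative D) (at p)"
  shows "Du f p = D (1, 0)" and "Dv f p = D (0, 1)"
  using frechet_derivative_at[OF assms] by (simp_all add: Du_def Dv_def)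

lemma has_derivative_Du_Dv:
  assumes "f differentiable (at p)"
  shows "(f has_derivative (\<lambda>h. fst h *\<^sub>R Du f p + snd h *\<^sub>R Dv f p)) (at p)"
proof -
  have d: "(f has_derivative frechet_derivative f (at p)) (at p)"
    using assms frechet_derivative_works by blast
  have "frechet_derivative f (at p) = (\<lambda>h. fst h *\<^sub>R Du f p + snd h *\<^sub>R Dv f p)"
    unfolding Du_def Dv_def
    by (rule ext, rule linear_pair_expand[OF has_derivative_linear[OF d]])
  then show ?thesis using d by simp
qed

text \<open>
  Two functions that agree on an open set have the same partial derivatives there. This is how an
  identity between functions on the surface is differentiated.
\<close>

lemma Du_Dv_cong:
  assumes "open S" "p \<in> S" "\<And>q. q \<in> S \<Longrightarrow> f q = g q" "(g has_derivative D) (at p)"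
  shows "Du f p = D (1, 0)" and "Dv f p = D (0, 1)"
proof -
  have "(f has_derivative D) (at p)"
    by (rule has_derivative_transform_within_open[OF assms(4,1,2)]) (simp add: assms(3))
  then show "Du f p = D (1, 0)" "Dv f p = D (0, 1)"
    by (rule Du_Dv_eqI)+
qed

lemma smooth_on_imp_differentiable:
  assumes "smooth_on S f" "p \<in> S"
  shows "f differentiable (at p)"
proof -
  have "Ck_on (Suc 0) S f" using assms(1) unfolding smooth_on_def by blast
  then show ?thesis using assms(2) by simp
qed

lemma smooth_on_frechet_derivative:
  assumes "smooth_on S f"
  shows "smooth_on S (\<lambda>x. frechet_derivative f (at x) v)"
  unfolding smooth_on_def
proof
  fix k
  have "Ck_on (Suc k) S f" using assms unfolding smooth_on_def by blast
  then show "Ck_on k S (\<lambda>x. frechet_derivative f (at x) v)" by simp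
qed

lemma smooth_on_Du_Dv:
  assumes "smooth_on S f"
  shows "smooth_on S (Du f)" and "smooth_on S (Dv f)"
proof -
  have "Du f = (\<lambda>p. frechet_derivative f (at p) (1, 0))"
    and "Dv f = (\<lambda>p. frechet_derivative f (at p) (0, 1))"
    by (simp_all add: Du_def Dv_def fun_eq_iff)
  then show "smooth_on S (Du f)" and "smooth_on S (Dv f)"
    using smooth_on_frechet_derivative[OF assms] by simp_all
qed

text \<open>
  The core of the symmetry of second derivatives: two applications of the mean value theorem
  express the second difference over a square by one value of the mixed derivative. Since the
  second difference does not change when the coordinates are exchanged, both mixed derivatives
  take a common second difference at points of each small square.
\<close>

lemma second_difference_mean_value:
  fixes F Fx Fxy :: "real \<Rightarrow> real \<Rightarrow> real"
  assumes "h > 0"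
    and Fx: "\<And>x y. x \<in> {a..a+h} \<Longrightarrow> y \<in> {b..b+h} \<Longrightarrow>
      ((\<lambda>x. F x y) has_real_derivative Fx x y) (at x)"
    and Fxy: "\<And>x y. x \<in> {a..a+h} \<Longrightarrow> y \<in> {b..b+h} \<Longrightarrow>
      ((\<lambda>y. Fx x y) has_real_derivative Fxy x y) (at y)"
  shows "\<exists>x\<in>{a..a+h}. \<exists>y\<in>{b..b+h}.
    F (a+h) (b+h) - F (a+h) b - F a (b+h) + F a b = h * h * Fxy x y"
proof -
  have "\<exists>x>a. x < a+h \<and> (F (a+h) (b+h) - F (a+h) b) - (F a (b+h) - F a b) =
      (a+h-a) * (Fx x (b+h) - Fx x b)"
    by (rule MVT2) (use \<open>h > 0\<close> in \<open>auto intro!: DERIV_diff Fx\<close>)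
  then obtain x where x: "a < x" "x < a+h"
    "(F (a+h) (b+h) - F (a+h) b) - (F a (b+h) - F a b) = h * (Fx x (b+h) - Fx x b)"
    by auto
  have "\<exists>y>b. y < b+h \<and> Fx x (b+h) - Fx x b = (b+h-b) * Fxy x y"
    by (rule MVT2) (use \<open>h > 0\<close> x in \<open>auto intro!: Fxy\<close>)
  then obtain y where y: "b < y" "y < b+h" "Fx x (b+h) - Fx x b = h * Fxy x y"
    by auto
  show ?thesis
    by (rule bexI[of _ x], rule bexI[of _ y]) (use x y in \<open>auto simp: algebra_simps\<close>)
qed

lemma DERIV_slices:
  fixes f :: "real \<times> real \<Rightarrow> real"
  assumes "f differentiable (at (x, y))"
  shows "((\<lambda>x. f (x, y)) has_real_derivative Du f (x, y)) (at x)"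
    and "((\<lambda>y. f (x, y)) has_real_derivative Dv f (x, y)) (at y)"
proof -
  note d = has_derivative_Du_Dv[OF assms]
  have "((\<lambda>x. (x, y)) has_derivative (\<lambda>h. (h, 0))) (at x)"
    by (intro has_derivative_Pair has_derivative_const has_derivative_ident)
  from has_derivative_compose[OF this d]
  show "((\<lambda>x. f (x, y)) has_real_derivative Du f (x, y)) (at x)"
    by (simp add: has_field_derivative_def mult_commute_abs)
  have "((\<lambda>y. (x, y)) has_derivative (\<lambda>h. (0, h))) (at y)"
    by (intro has_derivative_Pair has_derivative_const has_derivative_ident)
  from has_derivative_compose[OF this d]
  show "((\<lambda>y. f (x, y)) has_real_derivative Dv f (x, y)) (at y)"
    by (simp add: has_field_derivative_def mult_commute_abs)
qed

text \<open>
  If the mixed derivatives differed at \<open>p\<close>, continuity would keep them apart on a small square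
  at \<open>p\<close>, against \<open>second_difference_mean_value\<close> in both orders.
\<close>

lemma mixed_partials_real:
  fixes f :: "real \<times> real \<Rightarrow> real"
  assumes "open S" "p \<in> S"
    and diff: "\<And>q. q \<in> S \<Longrightarrow> f differentiable (at q)"
      "\<And>q. q \<in> S \<Longrightarrow> Du f differentiable (at q)"
      "\<And>q. q \<in> S \<Longrightarrow> Dv f differentiable (at q)"
    and cont: "isCont (Dv (Du f)) p" "isCont (Du (Dv f)) p"
  shows "Dv (Du f) p = Du (Dv f) p"
proof (rule ccontr)
  assume ne: "Dv (Du f) p \<noteq> Du (Dv f) p"
  define \<epsilon> where "\<epsilon> = dist (Dv (Du f) p) (Du (Dv f) p) / 2"
  have "\<epsilon> > 0" using ne by (simp add: \<epsilon>_def)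
  obtain d1 where d1: "d1 > 0" "\<And>q. dist q p < d1 \<Longrightarrow> dist (Dv (Du f) q) (Dv (Du f) p) < \<epsilon>"
    using cont(1) \<open>\<epsilon> > 0\<close> unfolding continuous_at_eps_delta by blast
  obtain d2 where d2: "d2 > 0" "\<And>q. dist q p < d2 \<Longrightarrow> dist (Du (Dv f) q) (Du (Dv f) p) < \<epsilon>"
    using cont(2) \<open>\<epsilon> > 0\<close> unfolding continuous_at_eps_delta by blast
  obtain d3 where d3: "d3 > 0" "\<And>q. dist q p < d3 \<Longrightarrow> q \<in> S"
    using assms(1,2) unfolding open_dist by blast
  \<comment> \<open>The square of side \<open>h\<close> has to lie in all three neighbourhoods; its diameter is less than \<open>4 h\<close>.\<close>
  define h where "h = min d1 (min d2 d3) / 4"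
  have h: "h > 0" "4 * h \<le> d1" "4 * h \<le> d2" "4 * h \<le> d3"
    using d1(1) d2(1) d3(1) by (auto simp: h_def)
  obtain a b where p: "p = (a, b)" by force
  have near: "dist (x, y) p < 4 * h" if "x \<in> {a..a+h}" "y \<in> {b..b+h}" for x y
  proof -
    have "dist (x, y) p \<le> \<bar>x - a\<bar> + \<bar>y - b\<bar>"
      unfolding p dist_Pair_Pair dist_real_def
      using sqrt_sum_squares_le_sum_abs by simp
    then show ?thesis using that h(1) by auto
  qed
  have inS: "(x, y) \<in> S" if "x \<in> {a..a+h}" "y \<in> {b..b+h}" for x y
    by (rule d3(2)) (use near[OF that] h(4) in linarith)
  obtain x1 y1 where 1: "x1 \<in> {a..a+h}" "y1 \<in> {b..b+h}"
    "f (a+h, b+h) - f (a+h, b) - f (a, b+h) + f (a, b) = h * h * Dv (Du f) (x1, y1)"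
    using second_difference_mean_value[of h a b "\<lambda>x y. f (x, y)" "\<lambda>x y. Du f (x, y)"
        "\<lambda>x y. Dv (Du f) (x, y)", OF h(1) DERIV_slices(1)[OF diff(1)[OF inS]]
        DERIV_slices(2)[OF diff(2)[OF inS]]] by auto
  obtain y2 x2 where 2: "y2 \<in> {b..b+h}" "x2 \<in> {a..a+h}"
    "f (a+h, b+h) - f (a, b+h) - f (a+h, b) + f (a, b) = h * h * Du (Dv f) (x2, y2)"
    using second_difference_mean_value[of h b a "\<lambda>y x. f (x, y)" "\<lambda>y x. Dv f (x, y)"
        "\<lambda>y x. Du (Dv f) (x, y)", OF h(1) DERIV_slices(2)[OF diff(1)[OF inS]]
        DERIV_slices(1)[OF diff(3)[OF inS]]] by auto
  have "h * h * Dv (Du f) (x1, y1) = h * h * Du (Dv f) (x2, y2)"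
    using 1(3) 2(3) by linarith
  then have eq: "Dv (Du f) (x1, y1) = Du (Dv f) (x2, y2)"
    using h(1) by simp
  have "dist (Dv (Du f) (x1, y1)) (Dv (Du f) p) < \<epsilon>"
    by (rule d1(2)) (use near[OF 1(1,2)] h(2) in linarith)
  moreover have "dist (Du (Dv f) (x2, y2)) (Du (Dv f) p) < \<epsilon>"
    by (rule d2(2)) (use near[OF 2(2,1)] h(3) in linarith)
  ultimately show False
    unfolding eq \<epsilon>_def dist_real_def by argo
qed

lemma Du_Dv_inner:
  fixes f :: "real \<times> real \<Rightarrow> 'b::real_inner"
  assumes "f differentiable (at p)"
  shows "Du (\<lambda>q. f q \<bullet> b) p = Du f p \<bullet> b" and "Dv (\<lambda>q. f q \<bullet> b) p = Dv f p \<bullet> b"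
    and "(\<lambda>q. f q \<bullet> b) differentiable (at p)"
proof -
  have d: "((\<lambda>q. f q \<bullet> b) has_derivative
      (\<lambda>h. (fst h *\<^sub>R Du f p + snd h *\<^sub>R Dv f p) \<bullet> b)) (at p)"
    by (rule has_derivative_inner_left[OF has_derivative_Du_Dv[OF assms]])
  show "Du (\<lambda>q. f q \<bullet> b) p = Du f p \<bullet> b" "Dv (\<lambda>q. f q \<bullet> b) p = Dv f p \<bullet> b"
    using Du_Dv_eqI[OF d] by simp_all
  show "(\<lambda>q. f q \<bullet> b) differentiable (at p)"
    using d by (auto simp: differentiable_def)
qed

lemma differentiable_cong_open:
  assumes "open S" "p \<in> S" "\<And>q. q \<in> S \<Longrightarrow> f q = g q" "g differentiable (at p)"
  shows "f differentiable (at p)"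
proof -
  obtain D where "(g has_derivative D) (at p)" using assms(4) by (auto simp: differentiable_def)
  then have "(f has_derivative D) (at p)"
    by (rule has_derivative_transform_within_open[OF _ assms(1,2)]) (simp add: assms(3))
  then show ?thesis by (auto simp: differentiable_def)
qed

lemma Du_Dv_cong':
  assumes "open S" "p \<in> S" "\<And>q. q \<in> S \<Longrightarrow> f q = g q" "g differentiable (at p)"
  shows "Du f p = Du g p" and "Dv f p = Dv g p"
  using Du_Dv_cong[OF assms(1-3) has_derivative_Du_Dv[OF assms(4)]] by simp_all

text \<open>
  For maps into a Euclidean space the symmetry follows coordinate by coordinate.
\<close>

lemma mixed_partials:
  fixes f :: "real \<times> real \<Rightarrow> 'b::euclidean_space"
  assumes "open S" "smooth_on S f" "p \<in> S"
  shows "Dv (Du f) p = Du (Dv f) p"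
proof (rule euclidean_eqI)
  fix b :: 'b assume "b \<in> Basis"
  note s1 = smooth_on_Du_Dv[OF assms(2)]
  note s2 = smooth_on_Du_Dv(2)[OF s1(1)] smooth_on_Du_Dv(1)[OF s1(2)]
  note diff = smooth_on_imp_differentiable
  define g where "g = (\<lambda>q. f q \<bullet> b)"
  have g0: "g differentiable (at q)" if "q \<in> S" for q
    unfolding g_def using Du_Dv_inner(3) diff assms(2) that by blast
  have gu: "Du g q = Du f q \<bullet> b" and gv: "Dv g q = Dv f q \<bullet> b" if "q \<in> S" for q
    unfolding g_def using Du_Dv_inner diff assms(2) that by blast+
  have gu': "Du g differentiable (at q)" "Dv (Du g) q = Dv (Du f) q \<bullet> b" if "q \<in> S" for q
    using differentiable_cong_open[OF assms(1) that gu] Du_Dv_cong'(2)[OF assms(1) that gu]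
      Du_Dv_inner[OF diff[OF s1(1) that]] by auto
  have gv': "Dv g differentiable (at q)" "Du (Dv g) q = Du (Dv f) q \<bullet> b" if "q \<in> S" for q
    using differentiable_cong_open[OF assms(1) that gv] Du_Dv_cong'(1)[OF assms(1) that gv]
      Du_Dv_inner[OF diff[OF s1(2) that]] by auto
  have c: "isCont (Dv (Du g)) p" "isCont (Du (Dv g)) p"
    using differentiable_cong_open[OF assms(1,3) gu'(2)] differentiable_cong_open[OF assms(1,3) gv'(2)]
      Du_Dv_inner(3)[OF diff[OF s2(1) assms(3)]] Du_Dv_inner(3)[OF diff[OF s2(2) assms(3)]]
    by (auto intro: differentiable_imp_continuous_within)
  have "Dv (Du g) p = Du (Dv g) p"
    by (rule mixed_partials_real[OF assms(1,3) g0 gu'(1) gv'(1) c])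
  then show "Dv (Du f) p \<bullet> b = Du (Dv f) p \<bullet> b"
    using gu'(2) gv'(2) assms(3) by simp
qed

section \<open>Lorentzian frames and rigidity of surfaces\<close>

lemma bounded_bilinear_lorentz: "bounded_bilinear lorentz"
proof
  show "\<exists>K. \<forall>x y. norm (lorentz x y) \<le> norm x * norm y * K"
  proof (intro exI allI)
    fix x y :: "real^3"
    have c: "\<bar>x$i * y$i\<bar> \<le> norm x * norm y" for i
      unfolding abs_mult by (intro mult_mono component_le_norm_cart norm_ge_zero abs_ge_zero)
    show "norm (lorentz x y) \<le> norm x * norm y * 3"
      unfolding lorentz_def real_norm_def using c[of 1] c[of 2] c[of 3] by linarith
  qed
qed (simp_all add: lorentz_def algebra_simps)

interpretation lorentz: bounded_bilinear lorentz
  by (rule bounded_bilinear_lorentz)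

lemmas lorentz_simps = lorentz.add_left lorentz.add_right lorentz.diff_left lorentz.diff_right
  lorentz.scaleR_left lorentz.scaleR_right lorentz.minus_left lorentz.minus_right

lemma lorentz_commute: "lorentz x y = lorentz y x"
  by (simp add: lorentz_def mult.commute)

definition orthonormal_frame :: "real^3 \<Rightarrow> real^3 \<Rightarrow> real^3 \<Rightarrow> bool" where
  "orthonormal_frame E1 E2 E3 \<longleftrightarrow>
     lorentz E1 E1 = 1 \<and> lorentz E2 E2 = -1 \<and> lorentz E3 E3 = 1 \<and>
     lorentz E1 E2 = 0 \<and> lorentz E1 E3 = 0 \<and> lorentz E2 E3 = 0"

text \<open>
  Orthonormality says that the matrix of the functionals \<open>lorentz w E\<^sub>i\<close>, with the sign of the
  timelike vector built in, is a left inverse of the matrix with columns \<open>E1\<close>, \<open>E2\<close>, \<open>E3\<close>.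
  For square matrices it is then also a right inverse, which is the expansion.
\<close>

lemma orthonormal_frame_expand:
  assumes "orthonormal_frame E1 E2 E3"
  shows "w = lorentz w E1 *\<^sub>R E1 - lorentz w E2 *\<^sub>R E2 + lorentz w E3 *\<^sub>R E3"
proof -
  define P :: "real^3^3" where
    "P = vector [vector [E1$1, E1$2, - E1$3], vector [- E2$1, - E2$2, E2$3],
                 vector [E3$1, E3$2, - E3$3]]"
  define Q :: "real^3^3" where
    "Q = vector [vector [E1$1, E2$1, E3$1], vector [E1$2, E2$2, E3$2],
                 vector [E1$3, E2$3, E3$3]]"
  have "P ** Q = mat 1"
    using assms unfolding orthonormal_frame_def lorentz_def P_def Q_def
    by (simp add: vec_eq_iff forall_3 matrix_matrix_mult_def sum_3 mat_def algebra_simps)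
  then have "Q ** P = mat 1"
    using matrix_left_right_inverse by blast
  then have "Q *v (P *v w) = w"
    by (simp add: matrix_vector_mul_assoc)
  moreover have "P *v w = vector [lorentz w E1, - lorentz w E2, lorentz w E3]"
    unfolding P_def lorentz_def
    by (simp add: vec_eq_iff forall_3 matrix_vector_mult_def sum_3 algebra_simps)
  moreover have "Q *v vector [x, y, z] = x *\<^sub>R E1 + y *\<^sub>R E2 + z *\<^sub>R E3" for x y z
    unfolding Q_def
    by (simp add: vec_eq_iff forall_3 matrix_vector_mult_def sum_3 algebra_simps)
  ultimately show ?thesis by simp
qed

lemma lorentz_expand:
  assumes "orthonormal_frame E1 E2 E3"
  shows "lorentz x y =
    lorentz x E1 * lorentz y E1 - lorentz x E2 * lorentz y E2 + lorentz x E3 * lorentz y E3"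
proof -
  have "lorentz x y = lorentz x
      (lorentz y E1 *\<^sub>R E1 - lorentz y E2 *\<^sub>R E2 + lorentz y E3 *\<^sub>R E3)"
    using orthonormal_frame_expand[OF assms, of y] by simp
  then show ?thesis by (simp add: lorentz_simps mult.commute)
qed

text \<open>
  Cartan's structure equations for a surface \<open>f\<close> in isothermal Lorentzian coordinates: the coframe
  is \<open>\<eta> du\<close>, \<open>\<eta> dv\<close>, the connection form is \<open>\<alpha>\<close>, and \<open>\<beta>\<close>, \<open>\<gamma>\<close> encode the second
  fundamental form. The signs are forced by orthonormality with \<open>E2\<close> timelike. Two surfaces
  have the same first and second fundamental forms if they share \<open>\<eta>\<close>, \<open>\<alpha>\<close>, \<open>\<beta>\<close>, \<open>\<gamma>\<close>.
\<close>

definition adapted_frame ::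
  "(real \<times> real) set \<Rightarrow> (real \<times> real \<Rightarrow> real \<times> real \<Rightarrow> real) \<Rightarrow>
   (real \<times> real \<Rightarrow> real \<times> real \<Rightarrow> real) \<Rightarrow> (real \<times> real \<Rightarrow> real \<times> real \<Rightarrow> real) \<Rightarrow> (real \<times> real \<Rightarrow> real) \<Rightarrow>
   (real \<times> real \<Rightarrow> real^3) \<Rightarrow> (real \<times> real \<Rightarrow> real^3) \<Rightarrow> (real \<times> real \<Rightarrow> real^3) \<Rightarrow>
   (real \<times> real \<Rightarrow> real^3) \<Rightarrow> bool" where
  "adapted_frame S \<alpha> \<beta> \<gamma> \<eta> f E1 E2 E3 \<longleftrightarrow> (\<forall>p\<in>S. orthonormal_frame (E1 p) (E2 p) (E3 p) \<and>
     (f has_derivative (\<lambda>h. (\<eta> p * fst h) *\<^sub>R E1 p + (\<eta> p * snd h) *\<^sub>R E2 p)) (at p) \<and>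
     (E1 has_derivative (\<lambda>h. \<alpha> p h *\<^sub>R E2 p + \<beta> p h *\<^sub>R E3 p)) (at p) \<and>
     (E2 has_derivative (\<lambda>h. \<alpha> p h *\<^sub>R E1 p + \<gamma> p h *\<^sub>R E3 p)) (at p) \<and>
     (E3 has_derivative (\<lambda>h. \<gamma> p h *\<^sub>R E2 p - \<beta> p h *\<^sub>R E1 p)) (at p))"

lemma constant_on_convex_if_derivative_zero:
  fixes f :: "'a::real_normed_vector \<Rightarrow> 'b::real_normed_vector"
  assumes "convex S" "\<And>p. p \<in> S \<Longrightarrow> (f has_derivative (\<lambda>h. 0)) (at p)" "p \<in> S" "q \<in> S"
  shows "f p = f q"
  using has_derivative_zero_unique[OF assms(1) has_derivative_at_withinI[OF assms(2)]] assms(3,4)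
  by metis

text \<open>
  The uniqueness half of Bonnet's theorem. At each point \<open>p\<close> let \<open>M p\<close> be the linear map that
  takes the first frame to the second one; it is an isometry. As both frames obey the same
  structure equations, and these are skew with respect to the metric, \<open>M p\<close> has derivative zero
  in \<open>p\<close>, so it is a constant \<open>L\<close>. Then \<open>g - L \<circ> f\<close> has derivative zero as well.
\<close>

theorem adapted_frame_rigidity:
  assumes "convex S"
    and E: "adapted_frame S \<alpha> \<beta> \<gamma> \<eta> f E1 E2 E3"
    and F: "adapted_frame S \<alpha> \<beta> \<gamma> \<eta> g F1 F2 F3"
  shows "\<exists>L b. linear L \<and> (\<forall>x y. lorentz (L x) (L y) = lorentz x y) \<and> (\<forall>p\<in>S. g p = L (f p) + b)"
proof (cases "S = {}")
  case True
  then show ?thesis by (intro exI[of _ id]) (auto simp: linear_id)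
next
  case False
  then obtain p0 where p0: "p0 \<in> S" by blast
  define M where "M p w = lorentz w (E1 p) *\<^sub>R F1 p - lorentz w (E2 p) *\<^sub>R F2 p
      + lorentz w (E3 p) *\<^sub>R F3 p" for p w
  define L where "L = M p0"
  have M: "M p w = L w" if "p \<in> S" for p w
  proof -
    have "((\<lambda>p. M p w) has_derivative (\<lambda>h. 0)) (at p)" if "p \<in> S" for p
    proof -
      have e: "(E1 has_derivative (\<lambda>h. \<alpha> p h *\<^sub>R E2 p + \<beta> p h *\<^sub>R E3 p)) (at p)"
        "(E2 has_derivative (\<lambda>h. \<alpha> p h *\<^sub>R E1 p + \<gamma> p h *\<^sub>R E3 p)) (at p)"
        "(E3 has_derivative (\<lambda>h. \<gamma> p h *\<^sub>R E2 p - \<beta> p h *\<^sub>R E1 p)) (at p)"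
        and f: "(F1 has_derivative (\<lambda>h. \<alpha> p h *\<^sub>R F2 p + \<beta> p h *\<^sub>R F3 p)) (at p)"
        "(F2 has_derivative (\<lambda>h. \<alpha> p h *\<^sub>R F1 p + \<gamma> p h *\<^sub>R F3 p)) (at p)"
        "(F3 has_derivative (\<lambda>h. \<gamma> p h *\<^sub>R F2 p - \<beta> p h *\<^sub>R F1 p)) (at p)"
        using E F that unfolding adapted_frame_def by blast+
      note b = bounded_linear.has_derivative[OF lorentz.bounded_linear_right]
      note d = has_derivative_add[OF has_derivative_diff[OF
          has_derivative_scaleR[OF b[OF e(1)] f(1)] has_derivative_scaleR[OF b[OF e(2)] f(2)]]
          has_derivative_scaleR[OF b[OF e(3)] f(3)], of w w w]
      show ?thesis unfolding M_def
        by (rule has_derivative_eq_rhs[OF d]) (simp add: lorentz_simps algebra_simps)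
    qed
    then show ?thesis
      unfolding L_def by (rule constant_on_convex_if_derivative_zero[OF assms(1) _ that p0])
  qed
  have Lf: "L (E1 p) = F1 p" "L (E2 p) = F2 p" if "p \<in> S" for p
    using E that unfolding M[OF that, symmetric] adapted_frame_def orthonormal_frame_def M_def
    by (auto simp: lorentz_commute)
  have "linear L"
    unfolding L_def M_def by (intro linearI) (simp_all add: lorentz_simps algebra_simps)
  have iso: "lorentz (L x) (L y) = lorentz x y" for x y
  proof -
    have "orthonormal_frame (E1 p0) (E2 p0) (E3 p0)"
      using E p0 unfolding adapted_frame_def by blast
    note lorentz_expand[OF this, of x y]
    moreover have "orthonormal_frame (F1 p0) (F2 p0) (F3 p0)"
      using F p0 unfolding adapted_frame_def by blast
    ultimately show ?thesis
      unfolding L_def M_def orthonormal_frame_def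
      by (simp add: lorentz_simps lorentz_commute[of "F2 p0" "F1 p0"] lorentz_commute[of "F3 p0" "F1 p0"]
          lorentz_commute[of "F3 p0" "F2 p0"])
  qed
  have "((\<lambda>p. g p - L (f p)) has_derivative (\<lambda>h. 0)) (at p)" if "p \<in> S" for p
  proof -
    have "(f has_derivative (\<lambda>h. (\<eta> p * fst h) *\<^sub>R E1 p + (\<eta> p * snd h) *\<^sub>R E2 p)) (at p)"
      using E that unfolding adapted_frame_def by blast
    from bounded_linear.has_derivative[OF linear_conv_bounded_linear[THEN iffD1, OF \<open>linear L\<close>] this]
    have "((\<lambda>p. L (f p)) has_derivative (\<lambda>h. (\<eta> p * fst h) *\<^sub>R F1 p + (\<eta> p * snd h) *\<^sub>R F2 p)) (at p)"
      using \<open>linear L\<close> Lf[OF that]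
      by (simp add: linear_add linear_scale)
    moreover have "(g has_derivative (\<lambda>h. (\<eta> p * fst h) *\<^sub>R F1 p + (\<eta> p * snd h) *\<^sub>R F2 p)) (at p)"
      using F that unfolding adapted_frame_def by blast
    ultimately show ?thesis
      using has_derivative_diff by fastforce
  qed
  from constant_on_convex_if_derivative_zero[OF assms(1) this _ p0]
  have "g p = L (f p) + (g p0 - L (f p0))" if "p \<in> S" for p
    using that by (auto simp: algebra_simps)
  then show ?thesis using \<open>linear L\<close> iso by blast
qed

section \<open>The model surfaces\<close>

lemma has_derivative_vector_3:
  fixes x y z :: "'a::real_normed_vector \<Rightarrow> real"
  assumes "(x has_derivative x') F" "(y has_derivative y') F" "(z has_derivative z') F"
  shows "((\<lambda>p. vector [x p, y p, z p] :: real^3) has_derivative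
    (\<lambda>h. vector [x' h, y' h, z' h])) F"
proof -
  have e: "(\<lambda>p. vector [f p, g p, k p] :: real^3) =
      (\<lambda>p. f p *\<^sub>R axis 1 1 + g p *\<^sub>R axis 2 1 + k p *\<^sub>R axis 3 1)" for f g k :: "'a \<Rightarrow> real"
    by (simp add: fun_eq_iff vec_eq_iff forall_3 axis_def)
  show ?thesis
    unfolding e by (intro has_derivative_add has_derivative_scaleR_left assms)
qed

lemma has_derivative_fst_snd_comp:
  fixes f :: "real \<Rightarrow> real"
  shows "(f has_real_derivative f') (at (fst p)) \<Longrightarrow>
      ((\<lambda>p. f (fst p)) has_derivative (\<lambda>h. f' * fst h)) (at p)"
    and "(f has_real_derivative f') (at (snd p)) \<Longrightarrow>
      ((\<lambda>p. f (snd p)) has_derivative (\<lambda>h. f' * snd h)) (at p)"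
  using DERIV_compose_FDERIV[of f f' fst p fst UNIV] DERIV_compose_FDERIV[of f f' snd p snd UNIV]
  by (simp_all add: has_derivative_fst has_derivative_snd has_derivative_ident mult.commute)

text \<open>
  The solutions of the wave equation from which the model surfaces are built. The case \<open>k = 0\<close> is
  chosen so that the derivatives in \<open>has_derivative_wave\<close> have one form for all \<open>k\<close>: only the
  potentials degenerate. This lets the three parametrizations be treated as a single surface.
\<close>

definition wave_cosh :: "real \<Rightarrow> real \<times> real \<Rightarrow> real" where
  "wave_cosh k p = (if k = 0 then fst p else exp (k * fst p) * cosh (k * snd p) / k)"

definition wave_sinh :: "real \<Rightarrow> real \<times> real \<Rightarrow> real" where
  "wave_sinh k p = (if k = 0 then snd p else exp (k * fst p) * sinh (k * snd p) / k)"

lemma has_derivative_wave: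
  "(wave_cosh k has_derivative
     (\<lambda>h. exp (k * fst p) * (cosh (k * snd p) * fst h + sinh (k * snd p) * snd h))) (at p)"
  "(wave_sinh k has_derivative
     (\<lambda>h. exp (k * fst p) * (sinh (k * snd p) * fst h + cosh (k * snd p) * snd h))) (at p)"
proof -
  have e: "((\<lambda>p. exp (k * fst p)) has_derivative (\<lambda>h. k * exp (k * fst p) * fst h)) (at p)"
    by (rule has_derivative_fst_snd_comp(1)) (auto intro!: derivative_eq_intros)
  have c: "((\<lambda>p. cosh (k * snd p)) has_derivative (\<lambda>h. k * sinh (k * snd p) * snd h)) (at p)"
    by (rule has_derivative_fst_snd_comp(2)) (auto intro!: derivative_eq_intros)
  have s: "((\<lambda>p. sinh (k * snd p)) has_derivative (\<lambda>h. k * cosh (k * snd p) * snd h)) (at p)"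
    by (rule has_derivative_fst_snd_comp(2)) (auto intro!: derivative_eq_intros)
  show "(wave_cosh k has_derivative
     (\<lambda>h. exp (k * fst p) * (cosh (k * snd p) * fst h + sinh (k * snd p) * snd h))) (at p)"
  proof (cases "k = 0")
    case False
    show ?thesis
      unfolding wave_cosh_def[abs_def] if_not_P[OF False]
      by (rule has_derivative_eq_rhs[OF bounded_linear.has_derivative[OF bounded_linear_divide
              has_derivative_mult[OF e c]]]) (use False in \<open>simp add: fun_eq_iff field_simps\<close>)
  qed (simp add: wave_cosh_def[abs_def] has_derivative_fst has_derivative_ident)
  show "(wave_sinh k has_derivative
     (\<lambda>h. exp (k * fst p) * (sinh (k * snd p) * fst h + cosh (k * snd p) * snd h))) (at p)"
  proof (cases "k = 0")
    case False
    show ?thesis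
      unfolding wave_sinh_def[abs_def] if_not_P[OF False]
      by (rule has_derivative_eq_rhs[OF bounded_linear.has_derivative[OF bounded_linear_divide
              has_derivative_mult[OF e s]]]) (use False in \<open>simp add: fun_eq_iff field_simps\<close>)
  qed (simp add: wave_sinh_def[abs_def] has_derivative_snd has_derivative_ident)
qed

text \<open>
  The three parametrizations at once. Along \<open>u + v\<close> and \<open>u - v\<close> the surface is a sum of two null
  curves, whose velocities are combinations of the exponentials with exponents
  \<open>2 a\<close>, \<open>2 a - B\<close> and \<open>2 a + B\<close>; when one of these exponents vanishes, the corresponding
  primitive becomes linear.
\<close>

definition model :: "real \<Rightarrow> real \<Rightarrow> real \<Rightarrow> real \<times> real \<Rightarrow> real^3" where
  "model a A B p = vector
     [wave_cosh (2*a) p / B,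
      wave_cosh (2*a - B) p / (2*A*B) - A * wave_cosh (2*a + B) p / (2*B),
      - wave_sinh (2*a - B) p / (2*A*B) - A * wave_sinh (2*a + B) p / (2*B)]"

text \<open>
  The function \<open>\<rho>\<close> of the model surface.
\<close>

definition conformal_factor :: "real \<Rightarrow> real \<Rightarrow> real \<Rightarrow> real \<Rightarrow> real" where
  "conformal_factor a A B u = exp (2*a*u) * cosh (B*u + ln A) / B"

lemma cosh_sinh_shift:
  assumes "A > (0::real)"
  shows "cosh (x + ln A) = (A * exp x + 1 / (A * exp x)) / 2"
    and "sinh (x + ln A) = (A * exp x - 1 / (A * exp x)) / 2"
  using assms by (simp_all add: cosh_def sinh_def exp_add exp_minus exp_diff exp_ln field_simps)

lemma cosh_neq_0: "cosh (x::real) \<noteq> 0"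
  using cosh_real_pos[of x] by linarith

text \<open>
  An explicit orthonormal frame along the model surface. With \<open>T\<close> and \<open>Z\<close> the hyperbolic tangent
  and secant of \<open>B u + ln A\<close>, the vectors \<open>F1\<close> and \<open>F2\<close> are the boost by \<open>2 a v\<close> of
  \<open>(Z, - T cosh (B v), - T sinh (B v))\<close> and \<open>(0, - sinh (B v), - cosh (B v))\<close>. All derivatives are
  polynomials in the functions named here, subject to \<open>hyperbolic_relations\<close>.
\<close>

locale twisted_model =
  fixes a A B :: real
  assumes A: "A > 0" and B: "B > 0"
begin

definition "ch p = cosh (B * snd p)"
definition "sh p = sinh (B * snd p)"
definition "CC p = cosh (2*a * snd p)"
definition "SS p = sinh (2*a * snd p)"
definition "T p = tanh (B * fst p + ln A)"
definition "Z p = inverse (cosh (B * fst p + ln A))"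

definition F1 :: "real \<times> real \<Rightarrow> real^3" where
  "F1 p = vector [CC p * Z p, - (CC p * T p * ch p) - SS p * sh p, - (SS p * ch p) - CC p * T p * sh p]"
definition F2 :: "real \<times> real \<Rightarrow> real^3" where
  "F2 p = vector [SS p * Z p, - (SS p * T p * ch p) - CC p * sh p, - (CC p * ch p) - SS p * T p * sh p]"
definition F3 :: "real \<times> real \<Rightarrow> real^3" where
  "F3 p = vector [- T p, - (Z p * ch p), - (Z p * sh p)]"

lemma hyperbolic_relations:
  "(Z p)\<^sup>2 = 1 - (T p)\<^sup>2" "(CC p)\<^sup>2 = 1 + (SS p)\<^sup>2" "(ch p)\<^sup>2 = 1 + (sh p)\<^sup>2"
proof -
  have "1 - (tanh x)\<^sup>2 = (inverse (cosh x))\<^sup>2" for x :: real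
  proof -
    have "1 - (tanh x)\<^sup>2 = ((cosh x)\<^sup>2 - (sinh x)\<^sup>2) / (cosh x)\<^sup>2"
      using cosh_neq_0[of x] by (simp add: tanh_def power_divide diff_divide_distrib)
    then show ?thesis
      by (simp add: hyperbolic_pythagoras power_inverse divide_inverse)
  qed
  then show "(Z p)\<^sup>2 = 1 - (T p)\<^sup>2" unfolding Z_def T_def by simp
qed (simp_all add: CC_def SS_def ch_def sh_def cosh_square_eq)

lemma hyperbolic_derivatives:
  "(CC has_derivative (\<lambda>h. 2*a * SS p * snd h)) (at p)"
  "(SS has_derivative (\<lambda>h. 2*a * CC p * snd h)) (at p)"
  "(ch has_derivative (\<lambda>h. B * sh p * snd h)) (at p)"
  "(sh has_derivative (\<lambda>h. B * ch p * snd h)) (at p)"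
  "(T has_derivative (\<lambda>h. B * (Z p)\<^sup>2 * fst h)) (at p)"
  "(Z has_derivative (\<lambda>h. - (B * T p * Z p) * fst h)) (at p)"
proof -
  note c = cosh_neq_0[of "B * fst p + ln A"]
  show "(CC has_derivative (\<lambda>h. 2*a * SS p * snd h)) (at p)"
    unfolding CC_def[abs_def] SS_def
    by (rule has_derivative_fst_snd_comp(2)[of "\<lambda>x. cosh (2*a*x)"]) (auto intro!: derivative_eq_intros)
  show "(SS has_derivative (\<lambda>h. 2*a * CC p * snd h)) (at p)"
    unfolding SS_def[abs_def] CC_def
    by (rule has_derivative_fst_snd_comp(2)[of "\<lambda>x. sinh (2*a*x)"]) (auto intro!: derivative_eq_intros)
  show "(ch has_derivative (\<lambda>h. B * sh p * snd h)) (at p)"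
    unfolding ch_def[abs_def] sh_def
    by (rule has_derivative_fst_snd_comp(2)[of "\<lambda>x. cosh (B*x)"]) (auto intro!: derivative_eq_intros)
  show "(sh has_derivative (\<lambda>h. B * ch p * snd h)) (at p)"
    unfolding sh_def[abs_def] ch_def
    by (rule has_derivative_fst_snd_comp(2)[of "\<lambda>x. sinh (B*x)"]) (auto intro!: derivative_eq_intros)
  show "(T has_derivative (\<lambda>h. B * (Z p)\<^sup>2 * fst h)) (at p)"
    unfolding hyperbolic_relations(1) T_def[abs_def]
    by (rule has_derivative_fst_snd_comp(1)[of "\<lambda>x. tanh (B*x + ln A)"])
       (use c in \<open>auto intro!: derivative_eq_intros\<close>)
  show "(Z has_derivative (\<lambda>h. - (B * T p * Z p) * fst h)) (at p)"
    unfolding Z_def[abs_def] T_def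
    by (rule has_derivative_fst_snd_comp(1)[of "\<lambda>x. inverse (cosh (B*x + ln A))"])
       (use c in \<open>auto intro!: derivative_eq_intros simp: tanh_def field_simps\<close>)
qed

text \<open>
  The forms \<open>\<alpha>\<close>, \<open>\<beta>\<close>, \<open>\<gamma>\<close> of the model frame.
\<close>

definition conn :: "real \<times> real \<Rightarrow> real \<times> real \<Rightarrow> real" where
  "conn p h = (2*a + B * T p) * snd h"
definition curv_u :: "real \<times> real \<Rightarrow> real \<times> real \<Rightarrow> real" where
  "curv_u p h = B * Z p * (CC p * fst h + SS p * snd h)"
definition curv_v :: "real \<times> real \<Rightarrow> real \<times> real \<Rightarrow> real" where
  "curv_v p h = B * Z p * (SS p * fst h + CC p * snd h)"

lemma frame_orthonormal: "orthonormal_frame (F1 p) (F2 p) (F3 p)"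
  unfolding orthonormal_frame_def F1_def F2_def F3_def lorentz_def vector_3
  using hyperbolic_relations[of p] by (intro conjI) algebra+

lemma frame_derivative:
  "(F1 has_derivative (\<lambda>h. conn p h *\<^sub>R F2 p + curv_u p h *\<^sub>R F3 p)) (at p)"
  "(F2 has_derivative (\<lambda>h. conn p h *\<^sub>R F1 p + curv_v p h *\<^sub>R F3 p)) (at p)"
  "(F3 has_derivative (\<lambda>h. curv_v p h *\<^sub>R F2 p - curv_u p h *\<^sub>R F1 p)) (at p)"
proof -
  note d = has_derivative_mult has_derivative_diff has_derivative_minus hyperbolic_derivatives
  have r: "Z p * Z p = 1 - T p * T p" "CC p * CC p = 1 + SS p * SS p"
    using hyperbolic_relations[of p] by (simp_all add: power2_eq_square)
  then have r': "Z p * (Z p * w) = w - T p * (T p * w)" "CC p * (CC p * w) = w + SS p * (SS p * w)" for w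
    by (simp_all only: mult.assoc[symmetric]) (simp_all add: left_diff_distrib distrib_right)
  show "(F1 has_derivative (\<lambda>h. conn p h *\<^sub>R F2 p + curv_u p h *\<^sub>R F3 p)) (at p)"
    unfolding F1_def[abs_def]
    apply (rule has_derivative_eq_rhs)
     apply (rule has_derivative_vector_3; (rule d)+)
    apply (rule ext)
    apply (simp add: vec_eq_iff forall_3 F2_def F3_def conn_def curv_u_def)
    apply (simp add: algebra_simps power2_eq_square r r')
    done
  show "(F2 has_derivative (\<lambda>h. conn p h *\<^sub>R F1 p + curv_v p h *\<^sub>R F3 p)) (at p)"
    unfolding F2_def[abs_def]
    apply (rule has_derivative_eq_rhs)
     apply (rule has_derivative_vector_3; (rule d)+)
    apply (rule ext)
    apply (simp add: vec_eq_iff forall_3 F1_def F3_def conn_def curv_v_def)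
    apply (simp add: algebra_simps power2_eq_square r r')
    done
  show "(F3 has_derivative (\<lambda>h. curv_v p h *\<^sub>R F2 p - curv_u p h *\<^sub>R F1 p)) (at p)"
    unfolding F3_def[abs_def]
    apply (rule has_derivative_eq_rhs)
     apply (rule has_derivative_vector_3; (rule d)+)
    apply (rule ext)
    apply (simp add: vec_eq_iff forall_3 F1_def F2_def curv_u_def curv_v_def)
    apply (simp add: algebra_simps power2_eq_square r r')
    done
qed

text \<open>
  The partial derivatives of the model are the conformal factor times \<open>F1\<close> and \<open>F2\<close>. With
  \<open>e = exp (2 a u)\<close> and \<open>x = A exp (B u)\<close> everything becomes rational in \<open>e\<close> and \<open>x\<close>, because
  \<open>cosh\<close> and \<open>sinh\<close> of \<open>B u + ln A\<close> are \<open>(x + 1/x) / 2\<close> and \<open>(x - 1/x) / 2\<close>.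
\<close>

lemma model_derivative:
  "(model a A B has_derivative
     (\<lambda>h. (conformal_factor a A B (fst p) * fst h) *\<^sub>R F1 p
        + (conformal_factor a A B (fst p) * snd h) *\<^sub>R F2 p)) (at p)"
proof -
  define e where "e = exp (2 * a * fst p)"
  define x where "x = A * exp (B * fst p)"
  have "x > 0" using A by (simp add: x_def)
  note c = cosh_neq_0[of "B * fst p + ln A"]
  have cf: "conformal_factor a A B (fst p) * Z p = e / B"
    "conformal_factor a A B (fst p) = e * (x + 1/x) / (2*B)"
    "conformal_factor a A B (fst p) * T p = e * (x - 1/x) / (2*B)"
  proof -
    have "conformal_factor a A B (fst p) * T p = e * sinh (B * fst p + ln A) / B"
      "conformal_factor a A B (fst p) * Z p = e / B"
      unfolding conformal_factor_def T_def Z_def tanh_def e_def using c by simp_all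
    then show "conformal_factor a A B (fst p) * Z p = e / B"
      "conformal_factor a A B (fst p) = e * (x + 1/x) / (2*B)"
      "conformal_factor a A B (fst p) * T p = e * (x - 1/x) / (2*B)"
      by (simp_all add: cosh_sinh_shift[OF A] e_def x_def conformal_factor_def)
  qed
  have ex: "exp ((2*a - B) * fst p) / A = e / x" "A * exp ((2*a + B) * fst p) = e * x"
    using A by (simp_all add: e_def x_def left_diff_distrib distrib_right exp_diff exp_add field_simps)
  have hy: "cosh ((2*a - B) * snd p) = CC p * ch p - SS p * sh p"
    "cosh ((2*a + B) * snd p) = CC p * ch p + SS p * sh p"
    "sinh ((2*a - B) * snd p) = SS p * ch p - CC p * sh p"
    "sinh ((2*a + B) * snd p) = SS p * ch p + CC p * sh p"
    by (simp_all add: left_diff_distrib distrib_right cosh_add sinh_add cosh_diff sinh_diff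
        CC_def SS_def ch_def sh_def)
  let ?\<eta> = "conformal_factor a A B (fst p)"
  have second: "exp ((2*a - B) * fst p) * y * inverse (2*A*B) - A * (exp ((2*a + B) * fst p) * z) * inverse (2*B)
      = e * (y / x - x * z) / (2*B)" for y z
  proof -
    have "exp ((2*a - B) * fst p) * y * inverse (2*A*B) - A * (exp ((2*a + B) * fst p) * z) * inverse (2*B)
        = (exp ((2*a - B) * fst p) / A * y - A * exp ((2*a + B) * fst p) * z) / (2*B)"
      using A B by (simp add: field_simps)
    also have "\<dots> = e * (y / x - x * z) / (2*B)"
      unfolding ex by (simp add: algebra_simps)
    finally show ?thesis .
  qed
  have third: "- (exp ((2*a - B) * fst p) * y) * inverse (2*A*B) - A * (exp ((2*a + B) * fst p) * z) * inverse (2*B)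
      = e * (- y / x - x * z) / (2*B)" for y z
    using second[of "- y" z] by simp
  show ?thesis
    unfolding model_def[abs_def] divide_inverse
  proof (rule has_derivative_eq_rhs)
    show "((\<lambda>p. vector [wave_cosh (2 * a) p * inverse B,
        wave_cosh (2 * a - B) p * inverse (2 * A * B) - A * wave_cosh (2 * a + B) p * inverse (2 * B),
        - wave_sinh (2 * a - B) p * inverse (2 * A * B) - A * wave_sinh (2 * a + B) p * inverse (2 * B)]
        :: real^3) has_derivative (\<lambda>h. vector
        [e * (CC p * fst h + SS p * snd h) * inverse B,
         e * ((cosh ((2*a-B) * snd p) * fst h + sinh ((2*a-B) * snd p) * snd h) / x
           - x * (cosh ((2*a+B) * snd p) * fst h + sinh ((2*a+B) * snd p) * snd h)) / (2*B),
         e * (- (sinh ((2*a-B) * snd p) * fst h + cosh ((2*a-B) * snd p) * snd h) / x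
           - x * (sinh ((2*a+B) * snd p) * fst h + cosh ((2*a+B) * snd p) * snd h)) / (2*B)])) (at p)"
      apply (rule has_derivative_eq_rhs)
       apply (rule has_derivative_vector_3)
         apply (rule has_derivative_mult_left has_derivative_mult_right has_derivative_diff
            has_derivative_minus has_derivative_wave)+
      apply (simp only: second third e_def CC_def SS_def)
      done
    show "(\<lambda>h. vector
        [e * (CC p * fst h + SS p * snd h) * inverse B,
         e * ((cosh ((2*a-B) * snd p) * fst h + sinh ((2*a-B) * snd p) * snd h) / x
           - x * (cosh ((2*a+B) * snd p) * fst h + sinh ((2*a+B) * snd p) * snd h)) / (2*B),
         e * (- (sinh ((2*a-B) * snd p) * fst h + cosh ((2*a-B) * snd p) * snd h) / x
           - x * (sinh ((2*a+B) * snd p) * fst h + cosh ((2*a+B) * snd p) * snd h)) / (2*B)] :: real^3)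
      = (\<lambda>h. (?\<eta> * fst h) *\<^sub>R F1 p + (?\<eta> * snd h) *\<^sub>R F2 p)"
    proof
      fix h
      have in_frame: "(?\<eta> * fst h) *\<^sub>R F1 p + (?\<eta> * snd h) *\<^sub>R F2 p = vector
        [(?\<eta> * Z p) * (CC p * fst h + SS p * snd h),
         - ((?\<eta> * T p) * (ch p * (CC p * fst h + SS p * snd h)))
           - ?\<eta> * (sh p * (SS p * fst h + CC p * snd h)),
         - ((?\<eta> * T p) * (sh p * (CC p * fst h + SS p * snd h)))
           - ?\<eta> * (ch p * (SS p * fst h + CC p * snd h))]"
        by (simp add: vec_eq_iff forall_3 F1_def F2_def algebra_simps)
      show "vector
        [e * (CC p * fst h + SS p * snd h) * inverse B,
         e * ((cosh ((2*a-B) * snd p) * fst h + sinh ((2*a-B) * snd p) * snd h) / x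
           - x * (cosh ((2*a+B) * snd p) * fst h + sinh ((2*a+B) * snd p) * snd h)) / (2*B),
         e * (- (sinh ((2*a-B) * snd p) * fst h + cosh ((2*a-B) * snd p) * snd h) / x
           - x * (sinh ((2*a+B) * snd p) * fst h + cosh ((2*a+B) * snd p) * snd h)) / (2*B)]
        = (?\<eta> * fst h) *\<^sub>R F1 p + (?\<eta> * snd h) *\<^sub>R F2 p"
        unfolding in_frame unfolding cf(1,3) unfolding cf(2) hy using \<open>x > 0\<close> B by (simp add: vec_eq_iff forall_3 field_simps)
    qed
  qed
qed

lemma adapted_frame_model:
  "adapted_frame S conn curv_u curv_v (\<lambda>p. conformal_factor a A B (fst p)) (model a A B) F1 F2 F3"
  unfolding adapted_frame_def
  using frame_orthonormal frame_derivative model_derivative by blast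

lemma conformal_factor_pos: "conformal_factor a A B u > 0"
  unfolding conformal_factor_def using B cosh_real_pos by simp

lemma model_first_form:
  "first_form (model a A B) p x y =
     (conformal_factor a A B (fst p))\<^sup>2 * (fst x * fst y - snd x * snd y)"
proof -
  have "tangent_map (model a A B) p =
      (\<lambda>h. (conformal_factor a A B (fst p) * fst h) *\<^sub>R F1 p
        + (conformal_factor a A B (fst p) * snd h) *\<^sub>R F2 p)"
    unfolding tangent_map_def using frechet_derivative_at[OF model_derivative] by simp
  then show ?thesis
    using frame_orthonormal[of p] unfolding first_form_def orthonormal_frame_def
    by (simp add: lorentz_simps lorentz_commute[of "F2 p" "F1 p"] algebra_simps power2_eq_square)
qed

lemma model_immersion: "immersion_at (model a A B) p"
  unfolding immersion_at_def
proof
  show d: "model a A B differentiable (at p)"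
    unfolding differentiable_def using model_derivative by blast
  have lin: "linear (tangent_map (model a A B) p)"
    unfolding tangent_map_def using d has_derivative_linear frechet_derivative_works by blast
  have "x = 0" if "tangent_map (model a A B) p x = 0" for x
  proof -
    have "first_form (model a A B) p x y = 0" for y
      unfolding first_form_def that by (rule lorentz.zero_left)
    from this[of "(1,0)"] this[of "(0,1)"] have "fst x = 0" "snd x = 0"
      using conformal_factor_pos[of "fst p"] unfolding model_first_form by auto
    then show ?thesis by (simp add: prod_eq_iff)
  qed
  then show "inj (tangent_map (model a A B) p)"
    using linear_injective_0[OF lin] by blast
qed

end

lemma model_eq_generic:
  assumes "A \<noteq> 0" "B \<noteq> 0" "a \<noteq> 0" "B \<noteq> 2*a" "B \<noteq> - 2*a"
  shows "model a A B = (\<lambda>(u, v). vector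
        [exp (2*a*u) * cosh (2*a* v) / (2*a*B),
         exp ((2*a - B)*u) *
           ((2*a + B) * cosh ((2*a - B)* v) - A\<^sup>2 * (2*a - B) * exp (2*B*u) * cosh ((2*a + B)* v))
           / (2*A*B*(4*a\<^sup>2 - B\<^sup>2)),
         - (exp ((2*a - B)*u) *
           (A\<^sup>2 * (2*a - B) * exp (2*B*u) * sinh ((2*a + B)* v) + (2*a + B) * sinh ((2*a - B)* v))
           / (2*A*B*(4*a\<^sup>2 - B\<^sup>2)))])"
proof (rule ext, clarify)
  fix u v
  have nz: "2*a - B \<noteq> 0" "2*a + B \<noteq> 0" using assms by auto
  have f: "4*a\<^sup>2 - B\<^sup>2 = (2*a - B) * (2*a + B)" by (simp add: power2_eq_square algebra_simps)
  have e: "exp ((2*a + B)*u) = exp ((2*a - B)*u) * exp (2*B*u)"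
    by (simp add: exp_add[symmetric] algebra_simps)
  have g: "x * (p * c - A\<^sup>2 * m * y * d) / (2*A*B*(m * p)) = x * c / m / (2*A*B) - A * (x * y * d / p) / (2*B)"
    if "m \<noteq> 0" "p \<noteq> 0" for x y c d m p
    using that assms(1,2) by (simp add: field_simps power2_eq_square)
  have g': "- (x * (A\<^sup>2 * m * y * d + p * c) / (2*A*B*(m * p))) = - (x * c / m) / (2*A*B) - A * (x * y * d / p) / (2*B)"
    if "m \<noteq> 0" "p \<noteq> 0" for x y c d m p
    using that assms(1,2) by (simp add: field_simps power2_eq_square)
  show "model a A B (u, v) = vector
        [exp (2*a*u) * cosh (2*a* v) / (2*a*B),
         exp ((2*a - B)*u) *
           ((2*a + B) * cosh ((2*a - B)* v) - A\<^sup>2 * (2*a - B) * exp (2*B*u) * cosh ((2*a + B)* v))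
           / (2*A*B*(4*a\<^sup>2 - B\<^sup>2)),
         - (exp ((2*a - B)*u) *
           (A\<^sup>2 * (2*a - B) * exp (2*B*u) * sinh ((2*a + B)* v) + (2*a + B) * sinh ((2*a - B)* v))
           / (2*A*B*(4*a\<^sup>2 - B\<^sup>2)))]"
    unfolding model_def f g[OF nz] g'[OF nz]
    using nz assms(3) by (simp add: wave_cosh_def wave_sinh_def e)
qed

lemma model_eq_plus:
  assumes "a \<noteq> 0"
  shows "model a A (2*a) = (\<lambda>(u, v). vector
        [exp (2*a*u) * cosh (2*a* v) / (4*a\<^sup>2),
         (4*a*u - A\<^sup>2 * exp (4*a*u) * cosh (4*a* v)) / (16*a\<^sup>2*A),
         - ((A\<^sup>2 * exp (4*a*u) * sinh (4*a* v) + 4*a* v) / (16*a\<^sup>2*A))])"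
  using assms
  by (cases "A = 0")
     (auto simp: fun_eq_iff model_def wave_cosh_def wave_sinh_def vec_eq_iff forall_3
       power2_eq_square field_simps)

lemma model_eq_minus:
  assumes "a \<noteq> 0" "A \<noteq> 0"
  shows "model a A (-2*a) = (\<lambda>(u, v). vector
        [- (exp (2*a*u) * cosh (2*a* v) / (4*a\<^sup>2)),
         (4*a*A\<^sup>2*u - exp (4*a*u) * cosh (4*a* v)) / (16*a\<^sup>2*A),
         (4*a*A\<^sup>2* v + exp (4*a*u) * sinh (4*a* v)) / (16*a\<^sup>2*A)])"
  using assms
  by (auto simp: fun_eq_iff model_def wave_cosh_def wave_sinh_def vec_eq_iff forall_3
       power2_eq_square field_simps)

lemma conformal_factor_square:
  assumes "A > 0" "B \<noteq> 0"
  shows "(conformal_factor a A B u)\<^sup>2 =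
    exp ((4*a - 2*B)*u) * (A\<^sup>2 * exp (2*B*u) + 1)\<^sup>2 / (4 * A\<^sup>2 * B\<^sup>2)"
proof -
  have "exp ((4*a - 2*B)*u) = (exp (2*a*u))\<^sup>2 / (exp (B*u))\<^sup>2"
    by (simp add: exp_double[symmetric] exp_diff[symmetric] algebra_simps)
  moreover have "exp (2*B*u) = (exp (B*u))\<^sup>2"
    by (simp add: exp_double[symmetric] algebra_simps)
  ultimately show ?thesis
    unfolding conformal_factor_def cosh_sinh_shift[OF assms(1)]
    using assms by (simp add: field_simps power2_eq_square)
qed

section \<open>A Liouville equation\<close>

lemma DERIV_zero_imp_const:
  fixes f :: "real \<Rightarrow> real"
  assumes "is_interval I" "\<And>u. u \<in> I \<Longrightarrow> (f has_real_derivative 0) (at u)" "x \<in> I" "y \<in> I"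
  shows "f x = f y"
  by (rule constant_on_convex_if_derivative_zero[OF is_interval_convex[OF assms(1)] _ assms(3,4)])
     (use assms(2) in \<open>simp add: has_field_derivative_def lambda_zero\<close>)

text \<open>
  For \<open>y = exp \<phi>\<close> the equation says \<open>\<phi>'' = exp (- 2 \<phi>)\<close>, a Liouville equation. It has the first
  integral \<open>(1 + y'\<^sup>2) / y\<^sup>2\<close>, a positive constant \<open>B\<^sup>2\<close>, and substituting this back leaves the
  linear equation \<open>y'' = B\<^sup>2 y\<close>. The two constants \<open>P\<close>, \<open>Q\<close> of the linear equation have product
  \<open>1\<close> by the first integral, and they are positive because \<open>y\<close> is; hence \<open>A = P\<close>.
\<close>

lemma liouville_ode_solution:
  fixes y y' y'' :: "real \<Rightarrow> real"
  assumes I: "is_interval I" "I \<noteq> {}"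
    and d: "\<And>u. u \<in> I \<Longrightarrow> (y has_real_derivative y' u) (at u)"
      "\<And>u. u \<in> I \<Longrightarrow> (y' has_real_derivative y'' u) (at u)"
    and pos: "\<And>u. u \<in> I \<Longrightarrow> y u > 0"
    and ode: "\<And>u. u \<in> I \<Longrightarrow> y u * y'' u - (y' u)\<^sup>2 = 1"
  shows "\<exists>A B. A > 0 \<and> B > 0 \<and> (\<forall>u\<in>I. y u = cosh (B * u + ln A) / B)"
proof -
  obtain u0 where u0: "u0 \<in> I" using I(2) by blast
  define k where "k u = (1 + (y' u)\<^sup>2) / (y u)\<^sup>2" for u
  have k_const: "k u = k u0" if "u \<in> I" for u
  proof (rule DERIV_zero_imp_const[OF I(1) _ that u0])
    fix u assume u: "u \<in> I"
    have "y u \<noteq> 0" using pos[OF u] by simp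
    have "(k has_real_derivative
        (2 * y' u * y'' u * (y u)\<^sup>2 - (1 + (y' u)\<^sup>2) * (2 * y u * y' u)) / ((y u)\<^sup>2 * (y u)\<^sup>2)) (at u)"
      unfolding k_def[abs_def]
      by (auto intro!: derivative_eq_intros d[OF u] simp: \<open>y u \<noteq> 0\<close>)
    moreover have "2 * y' u * y'' u * (y u)\<^sup>2 - (1 + (y' u)\<^sup>2) * (2 * y u * y' u) = 0"
      using ode[OF u] by algebra
    ultimately show "(k has_real_derivative 0) (at u)" by simp
  qed
  define B where "B = sqrt (k u0)"
  have "k u0 > 0"
    unfolding k_def using pos[OF u0] by (auto intro!: divide_pos_pos add_pos_nonneg)
  then have B: "B > 0" "B\<^sup>2 = k u0" by (simp_all add: B_def)
  have energy: "1 + (y' u)\<^sup>2 = B\<^sup>2 * (y u)\<^sup>2" if "u \<in> I" for u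
  proof -
    have "(1 + (y' u)\<^sup>2) / (y u)\<^sup>2 = B\<^sup>2"
      using k_const[OF that] unfolding B(2) by (simp only: k_def)
    then show ?thesis using pos[OF that] by (simp add: nonzero_divide_eq_eq)
  qed
  have lin: "y'' u = B\<^sup>2 * y u" if "u \<in> I" for u
  proof -
    have "y u * y'' u = y u * (B\<^sup>2 * y u)"
      using energy[OF that] ode[OF that] by algebra
    then show ?thesis using pos[OF that] by simp
  qed
  define P where "P u = (B * y u + y' u) * exp (- B * u)" for u
  define Q where "Q u = (B * y u - y' u) * exp (B * u)" for u
  have P: "P u = P u0" if "u \<in> I" for u
  proof (rule DERIV_zero_imp_const[OF I(1) _ that u0])
    fix u assume u: "u \<in> I"
    show "(P has_real_derivative 0) (at u)"
      unfolding P_def[abs_def]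
      by (auto intro!: derivative_eq_intros d[OF u] simp: lin[OF u] power2_eq_square algebra_simps)
  qed
  have Q: "Q u = Q u0" if "u \<in> I" for u
  proof (rule DERIV_zero_imp_const[OF I(1) _ that u0])
    fix u assume u: "u \<in> I"
    show "(Q has_real_derivative 0) (at u)"
      unfolding Q_def[abs_def]
      by (auto intro!: derivative_eq_intros d[OF u] simp: lin[OF u] power2_eq_square algebra_simps)
  qed
  have PQ: "P u0 * Q u0 = 1"
  proof -
    have "P u0 * Q u0 = (B * y u0 + y' u0) * (B * y u0 - y' u0) * (exp (- B * u0) * exp (B * u0))"
      unfolding P_def Q_def by (simp only: mult_ac)
    also have "exp (- B * u0) * exp (B * u0) = 1"
      by (simp add: exp_add[symmetric])
    finally show ?thesis using energy[OF u0] by algebra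
  qed
  have y: "2 * B * y u = P u0 * exp (B * u) + Q u0 * exp (- B * u)" if "u \<in> I" for u
  proof -
    have "P u * exp (B * u) + Q u * exp (- B * u) = 2 * B * y u * (exp (- B * u) * exp (B * u))"
      unfolding P_def Q_def by (simp add: algebra_simps)
    also have "exp (- B * u) * exp (B * u) = 1"
      by (simp add: exp_add[symmetric])
    finally show ?thesis using P[OF that] Q[OF that] by simp
  qed
  have "P u0 > 0"
  proof (rule ccontr)
    assume "\<not> P u0 > 0"
    moreover have "P u0 \<noteq> 0" using PQ by auto
    ultimately have "P u0 < 0" by simp
    moreover from this have "Q u0 < 0"
      using PQ by (metis mult_nonpos_nonneg less_imp_le not_le not_one_le_zero)
    ultimately
    have "P u0 * exp (B * u0) + Q u0 * exp (- B * u0) < 0"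
      by (intro add_neg_neg mult_neg_pos) auto
    moreover have "2 * B * y u0 > 0" using B(1) pos[OF u0] by simp
    ultimately show False using y[OF u0] by linarith
  qed
  moreover have "y u = cosh (B * u + ln (P u0)) / B" if "u \<in> I" for u
  proof -
    have "Q u0 = 1 / P u0" using PQ \<open>P u0 > 0\<close> by (simp add: field_simps)
    then have "2 * B * y u = P u0 * exp (B * u) + 1 / (P u0 * exp (B * u))"
      using y[OF that] by (simp add: exp_minus field_simps)
    then show ?thesis
      unfolding cosh_sinh_shift[OF \<open>P u0 > 0\<close>] using B(1) by (simp add: field_simps)
  qed
  ultimately show ?thesis using B(1) by blast
qed

section \<open>The Gauss and Codazzi equations of a twisted minimal surface\<close>

lemma Du_Dv_lorentz:
  assumes "f differentiable (at p)" "g differentiable (at p)"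
  shows "Du (\<lambda>q. lorentz (f q) (g q)) p = lorentz (Du f p) (g p) + lorentz (f p) (Du g p)"
    and "Dv (\<lambda>q. lorentz (f q) (g q)) p = lorentz (Dv f p) (g p) + lorentz (f p) (Dv g p)"
    and "(\<lambda>q. lorentz (f q) (g q)) differentiable (at p)"
proof -
  note d = lorentz.FDERIV[OF has_derivative_Du_Dv[OF assms(1)] has_derivative_Du_Dv[OF assms(2)]]
  show "Du (\<lambda>q. lorentz (f q) (g q)) p = lorentz (Du f p) (g p) + lorentz (f p) (Du g p)"
    and "Dv (\<lambda>q. lorentz (f q) (g q)) p = lorentz (Dv f p) (g p) + lorentz (f p) (Dv g p)"
    using Du_Dv_eqI[OF d] by simp_all
  show "(\<lambda>q. lorentz (f q) (g q)) differentiable (at p)"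
    unfolding differentiable_def using d by blast
qed

lemma smooth_on_DERIV:
  fixes f :: "real \<Rightarrow> real"
  assumes "smooth_on S f" "x \<in> S"
  shows "(f has_real_derivative frechet_derivative f (at x) 1) (at x)"
proof -
  have d: "(f has_derivative frechet_derivative f (at x)) (at x)"
    using smooth_on_imp_differentiable[OF assms] frechet_derivative_works by blast
  then obtain c where "frechet_derivative f (at x) = (\<lambda>h. h * c)"
    using real_bounded_linear[of "frechet_derivative f (at x)"] has_derivative_bounded_linear by blast
  then show ?thesis
    using d by (simp add: has_field_derivative_def mult_commute_abs)
qed

locale isothermal_surface =
  fixes \<rho> :: "real \<Rightarrow> real" and I J :: "real set" and r N :: "real \<times> real \<Rightarrow> real^3"
  assumes I: "open I" "is_interval I" "I \<noteq> {}" and J: "open J" "is_interval J" "J \<noteq> {}"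
    and smooth: "smooth_on (I \<times> J) r" "smooth_on (I \<times> J) N" "smooth_on I \<rho>"
    and \<rho>_pos: "\<And>u. u \<in> I \<Longrightarrow> \<rho> u > 0"
    and form: "\<And>p. p \<in> I \<times> J \<Longrightarrow> lorentz (Du r p) (Du r p) = (\<rho> (fst p))\<^sup>2"
      "\<And>p. p \<in> I \<times> J \<Longrightarrow> lorentz (Dv r p) (Dv r p) = - (\<rho> (fst p))\<^sup>2"
      "\<And>p. p \<in> I \<times> J \<Longrightarrow> lorentz (Du r p) (Dv r p) = 0"
    and normal: "\<And>p. p \<in> I \<times> J \<Longrightarrow> lorentz (N p) (N p) = 1"
      "\<And>p. p \<in> I \<times> J \<Longrightarrow> lorentz (Du r p) (N p) = 0"
      "\<And>p. p \<in> I \<times> J \<Longrightarrow> lorentz (Dv r p) (N p) = 0"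
begin

abbreviation "S \<equiv> I \<times> J"

lemma openS: "open S" using I(1) J(1) by (rule open_Times)

lemma fstS: "p \<in> S \<Longrightarrow> fst p \<in> I" by auto

lemma orthonormal:
  assumes p: "p \<in> S" and "s\<^sup>2 = 1"
  shows "orthonormal_frame ((s / \<rho> (fst p)) *\<^sub>R Du r p) ((s / \<rho> (fst p)) *\<^sub>R Dv r p) (N p)"
proof -
  have "\<rho> (fst p) \<noteq> 0" using \<rho>_pos[OF fstS[OF p]] by simp
  moreover have "s * s = 1" using assms(2) by (simp add: power2_eq_square)
  ultimately show ?thesis
    unfolding orthonormal_frame_def
    by (simp add: lorentz_simps form[OF p] normal[OF p] power2_eq_square)
qed

lemma expand:
  assumes p: "p \<in> S"
  shows "w = (lorentz w (Du r p) / (\<rho> (fst p))\<^sup>2) *\<^sub>R Du r p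
    - (lorentz w (Dv r p) / (\<rho> (fst p))\<^sup>2) *\<^sub>R Dv r p + lorentz w (N p) *\<^sub>R N p"
  using orthonormal_frame_expand[OF orthonormal[OF p, of 1], of w]
  by (simp add: lorentz_simps power2_eq_square)

lemma Du_Dv_fst:
  assumes "p \<in> S" "\<And>q. q \<in> S \<Longrightarrow> f q = g (fst q)" "(g has_real_derivative g') (at (fst p))"
  shows "Du f p = g'" "Dv f p = 0"
  using Du_Dv_cong[OF openS assms(1,2) has_derivative_fst_snd_comp(1)[OF assms(3)]] by simp_all

text \<open>
  Differentiating an orthogonality relation moves a derivative from one factor to the other.
\<close>

lemma Du_Dv_orthogonal:
  assumes "p \<in> S" "f differentiable (at p)" "g differentiable (at p)"
    "\<And>q. q \<in> S \<Longrightarrow> lorentz (f q) (g q) = 0"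
  shows "lorentz (Du f p) (g p) = - lorentz (f p) (Du g p)"
    "lorentz (Dv f p) (g p) = - lorentz (f p) (Dv g p)"
proof -
  have "Du (\<lambda>q. lorentz (f q) (g q)) p = 0" "Dv (\<lambda>q. lorentz (f q) (g q)) p = 0"
    using Du_Dv_cong[OF openS assms(1,4) has_derivative_const] by auto
  then show "lorentz (Du f p) (g p) = - lorentz (f p) (Du g p)"
    "lorentz (Dv f p) (g p) = - lorentz (f p) (Dv g p)"
    unfolding Du_Dv_lorentz[OF assms(2,3)] by linarith+
qed

lemma differentiable:
  assumes "p \<in> S"
  shows "r differentiable (at p)" "N differentiable (at p)" "Du r differentiable (at p)"
    "Dv r differentiable (at p)" "Du (Du r) differentiable (at p)" "Dv (Du r) differentiable (at p)"
  using smooth_on_imp_differentiable[OF _ assms] smooth(1,2) smooth_on_Du_Dv by metis+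

lemma mixed: "p \<in> S \<Longrightarrow> Du (Dv r) p = Dv (Du r) p"
  using mixed_partials[OF openS smooth(1)] by simp

lemma mixed3: "p \<in> S \<Longrightarrow> Dv (Du (Du r)) p = Du (Dv (Du r)) p"
  using mixed_partials[OF openS smooth_on_Du_Dv(1)[OF smooth(1)]] by simp

lemma surface_derivative:
  assumes "p \<in> S"
  shows "tangent_map r p x = fst x *\<^sub>R Du r p + snd x *\<^sub>R Dv r p"
    "frechet_derivative N (at p) x = fst x *\<^sub>R Du N p + snd x *\<^sub>R Dv N p"
  unfolding tangent_map_def
    frechet_derivative_at[OF has_derivative_Du_Dv[OF differentiable(1)[OF assms]], symmetric]
    frechet_derivative_at[OF has_derivative_Du_Dv[OF differentiable(2)[OF assms]], symmetric]
  by (rule refl)+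

text \<open>
  Since \<open>N\<close> has constant length, its derivatives are already tangential.
\<close>

lemma weingarten_eq:
  assumes p: "p \<in> S"
  shows "weingarten r N p x = - (fst x *\<^sub>R Du N p + snd x *\<^sub>R Dv N p)"
proof -
  define w where "w = fst x *\<^sub>R Du N p + snd x *\<^sub>R Dv N p"
  note d = differentiable[OF p]
  have "Du (\<lambda>q. lorentz (N q) (N q)) p = 0" "Dv (\<lambda>q. lorentz (N q) (N q)) p = 0"
    using Du_Dv_cong[OF openS p normal(1) has_derivative_const] by auto
  then have "lorentz (Du N p) (N p) = 0" "lorentz (Dv N p) (N p) = 0"
    unfolding Du_Dv_lorentz[OF d(2) d(2)]
    using lorentz_commute[of "N p" "Du N p"] lorentz_commute[of "N p" "Dv N p"] by simp_all
  then have wN: "lorentz w (N p) = 0"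
    by (simp add: w_def lorentz_simps)
  have "tangential_part r p w = w"
    unfolding tangential_part_def
  proof (rule the_equality)
    have "w = tangent_map r p (lorentz w (Du r p) / (\<rho> (fst p))\<^sup>2, - (lorentz w (Dv r p) / (\<rho> (fst p))\<^sup>2))"
      using expand[OF p, of w] wN by (simp add: surface_derivative[OF p])
    then show "w \<in> range (tangent_map r p) \<and> (\<forall>x. lorentz (w - w) (tangent_map r p x) = 0)"
      by (auto simp: lorentz.zero_left)
  next
    fix t assume t: "t \<in> range (tangent_map r p) \<and> (\<forall>x. lorentz (w - t) (tangent_map r p x) = 0)"
    then obtain y where y: "t = fst y *\<^sub>R Du r p + snd y *\<^sub>R Dv r p"
      by (auto simp: surface_derivative[OF p])
    have "lorentz (w - t) (Du r p) = 0" "lorentz (w - t) (Dv r p) = 0"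
      using t[THEN conjunct2, rule_format, of "(1,0)"] t[THEN conjunct2, rule_format, of "(0,1)"]
      by (simp_all add: surface_derivative[OF p])
    moreover have "lorentz (w - t) (N p) = 0"
      using wN unfolding y by (simp add: lorentz_simps normal[OF p])
    ultimately have "w - t = 0"
      using expand[OF p, of "w - t"] by simp
    then show "t = w" by simp
  qed
  then show ?thesis
    unfolding weingarten_def surface_derivative(2)[OF p] w_def by simp
qed

text \<open>
  The sum of the eigenvalues is the trace. It is read off from
  \<open>det (M e1, e2) + det (e1, M e2) = trace M * det (e1, e2)\<close>, where \<open>D\<close> is the last determinant.
\<close>

lemma principal_curvatures_sum:
  assumes p: "p \<in> S" and M: "weingarten_matrix r N p M" and k: "principal_curvatures r N p k1 k2"
  shows "k1 + k2 = M$1$1 + M$2$2"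
proof -
  obtain e1 e2 where e: "e1 \<noteq> e2" "independent {e1, e2}"
    "weingarten r N p e1 = k1 *\<^sub>R tangent_map r p e1"
    "weingarten r N p e2 = k2 *\<^sub>R tangent_map r p e2"
    using k unfolding principal_curvatures_def by (elim exE conjE) (rule that)
  define D where "D = fst e1 * snd e2 - snd e1 * fst e2"
  have "D \<noteq> 0"
  proof
    assume "D = 0"
    have nz: "e1 \<noteq> 0" "e2 \<noteq> 0" using e(2) dependent_zero[of "{e1, e2}"] by auto
    have "e1 \<notin> span {e2}" using e(1,2) by (simp add: independent_insert)
    then have *: "e1 \<noteq> c *\<^sub>R e2" for c using span_scale[OF span_base[of e2 "{e2}"], of c] by auto
    show False
    proof (cases "fst e2 = 0")
      case True
      then have "snd e2 \<noteq> 0" using nz(2) by (simp add: prod_eq_iff)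
      then show False using *[of "snd e1 / snd e2"] True \<open>D = 0\<close>
        by (auto simp: D_def prod_eq_iff)
    next
      case False
      then show False using *[of "fst e1 / fst e2"] \<open>D = 0\<close>
        by (auto simp: D_def prod_eq_iff field_simps)
    qed
  qed
  have coords: "M$1$1 * fst e + M$1$2 * snd e = k * fst e \<and> M$2$1 * fst e + M$2$2 * snd e = k * snd e"
    if "weingarten r N p e = k *\<^sub>R tangent_map r p e" for e k
  proof -
    have "weingarten r N p e = fst e *\<^sub>R weingarten r N p (1,0) + snd e *\<^sub>R weingarten r N p (0,1)"
      by (simp add: weingarten_eq[OF p])
    also have "\<dots> = (M$1$1 * fst e + M$1$2 * snd e) *\<^sub>R Du r p + (M$2$1 * fst e + M$2$2 * snd e) *\<^sub>R Dv r p"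
      using M unfolding weingarten_matrix_def by (simp add: surface_derivative[OF p] algebra_simps)
    finally have "(M$1$1 * fst e + M$1$2 * snd e - k * fst e) *\<^sub>R Du r p
        + (M$2$1 * fst e + M$2$2 * snd e - k * snd e) *\<^sub>R Dv r p = 0"
      using that by (simp add: surface_derivative[OF p] algebra_simps)
    then have "lorentz ((M$1$1 * fst e + M$1$2 * snd e - k * fst e) *\<^sub>R Du r p
        + (M$2$1 * fst e + M$2$2 * snd e - k * snd e) *\<^sub>R Dv r p) w = 0" for w
      by (simp only: lorentz.zero_left)
    from this[of "Du r p"] this[of "Dv r p"] show ?thesis
      using \<rho>_pos[OF fstS[OF p]]
      by (simp add: lorentz_simps form[OF p] lorentz_commute[of "Dv r p" "Du r p"])
  qed
  have "(k1 + k2) * D = (M$1$1 + M$2$2) * D"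
    using coords[OF e(3)] coords[OF e(4)] unfolding D_def by algebra
  then show ?thesis using \<open>D \<noteq> 0\<close> by simp
qed

end

text \<open>
  With principal curvatures \<open>l\<close> and \<open>- l\<close>, conjugating \<open>diag (l, - l)\<close> by the boost of angle
  \<open>a v\<close> gives \<open>l\<close> times a matrix of hyperbolic functions of the double angle \<open>2 a v\<close>. Lowering
  an index multiplies it by \<open>\<rho>\<^sup>2\<close>, so \<open>\<mu> = l \<rho>\<^sup>2\<close> is the scalar factor of the second
  fundamental form.
\<close>

locale twisted_minimal = isothermal_surface +
  fixes a :: real and l :: "real \<Rightarrow> real"
  assumes a: "a \<noteq> 0"
    and shape: "\<And>p. p \<in> I \<times> J \<Longrightarrow>
        Du N p = - l (fst p) *\<^sub>R (cosh (2*a * snd p) *\<^sub>R Du r p - sinh (2*a * snd p) *\<^sub>R Dv r p)"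
      "\<And>p. p \<in> I \<times> J \<Longrightarrow>
        Dv N p = - l (fst p) *\<^sub>R (sinh (2*a * snd p) *\<^sub>R Du r p - cosh (2*a * snd p) *\<^sub>R Dv r p)"
begin

definition "\<rho>' u = frechet_derivative \<rho> (at u) 1"
definition "\<rho>'' u = frechet_derivative \<rho>' (at u) 1"
definition "\<mu> u = l u * (\<rho> u)\<^sup>2"
abbreviation "C p \<equiv> cosh (2*a * snd p)"
abbreviation "H p \<equiv> sinh (2*a * snd p)"

lemma \<rho>_deriv:
  assumes "u \<in> I"
  shows "(\<rho> has_real_derivative \<rho>' u) (at u)" "(\<rho>' has_real_derivative \<rho>'' u) (at u)"
proof -
  show "(\<rho> has_real_derivative \<rho>' u) (at u)"
    unfolding \<rho>'_def by (rule smooth_on_DERIV[OF smooth(3) assms])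
  have "smooth_on I \<rho>'"
    using smooth_on_frechet_derivative[OF smooth(3), of 1] unfolding \<rho>'_def[abs_def] .
  then show "(\<rho>' has_real_derivative \<rho>'' u) (at u)"
    unfolding \<rho>''_def by (rule smooth_on_DERIV[OF _ assms])
qed

text \<open>
  The Christoffel symbols, obtained by differentiating the three relations \<open>form\<close>.
\<close>

lemma second_derivatives_tangential:
  assumes p: "p \<in> S"
  shows "lorentz (Du (Du r) p) (Du r p) = \<rho> (fst p) * \<rho>' (fst p)"
    "lorentz (Dv (Du r) p) (Du r p) = 0"
    "lorentz (Dv (Du r) p) (Dv r p) = - (\<rho> (fst p) * \<rho>' (fst p))"
    "lorentz (Dv (Dv r) p) (Dv r p) = 0"
    "lorentz (Du (Du r) p) (Dv r p) = 0"
    "lorentz (Dv (Dv r) p) (Du r p) = \<rho> (fst p) * \<rho>' (fst p)"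
proof -
  note d = differentiable[OF p]
  note u = fstS[OF p]
  have d2: "((\<lambda>u. (\<rho> u)\<^sup>2) has_real_derivative 2 * (\<rho> (fst p) * \<rho>' (fst p))) (at (fst p))"
    "((\<lambda>u. - (\<rho> u)\<^sup>2) has_real_derivative - (2 * (\<rho> (fst p) * \<rho>' (fst p)))) (at (fst p))"
    using \<rho>_deriv(1)[OF u] by (auto intro!: derivative_eq_intros)
  note E = Du_Dv_fst[OF p form(1) d2(1)]
  note G = Du_Dv_fst[OF p form(2) d2(2)]
  note F = Du_Dv_orthogonal[OF p d(3) d(4) form(3)]
  show 1: "lorentz (Du (Du r) p) (Du r p) = \<rho> (fst p) * \<rho>' (fst p)"
    using E(1) unfolding Du_Dv_lorentz[OF d(3) d(3)] by (simp add: lorentz_commute)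
  show 2: "lorentz (Dv (Du r) p) (Du r p) = 0"
    using E(2) unfolding Du_Dv_lorentz[OF d(3) d(3)] by (simp add: lorentz_commute)
  show 3: "lorentz (Dv (Du r) p) (Dv r p) = - (\<rho> (fst p) * \<rho>' (fst p))"
    using G(1) unfolding Du_Dv_lorentz[OF d(4) d(4)] mixed[OF p] by (simp add: lorentz_commute)
  show 4: "lorentz (Dv (Dv r) p) (Dv r p) = 0"
    using G(2) unfolding Du_Dv_lorentz[OF d(4) d(4)] by (simp add: lorentz_commute)
  show "lorentz (Du (Du r) p) (Dv r p) = 0"
    using F(1) 2 unfolding mixed[OF p] by (simp add: lorentz_commute[of "Du r p" "Dv (Du r) p"])
  show "lorentz (Dv (Dv r) p) (Du r p) = \<rho> (fst p) * \<rho>' (fst p)"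
    using F(2) 3 by (simp add: lorentz_commute[of "Du r p" "Dv (Dv r) p"])
qed

text \<open>
  The second fundamental form is \<open>\<mu>\<close> times a symmetric matrix of hyperbolic functions of \<open>v\<close>.
\<close>

lemma second_derivatives_normal:
  assumes p: "p \<in> S"
  shows "lorentz (Du (Du r) p) (N p) = \<mu> (fst p) * C p"
    "lorentz (Dv (Du r) p) (N p) = \<mu> (fst p) * H p"
    "lorentz (Dv (Dv r) p) (N p) = \<mu> (fst p) * C p"
proof -
  note d = differentiable[OF p]
  note X = Du_Dv_orthogonal[OF p d(3) d(2) normal(2)]
  note Y = Du_Dv_orthogonal[OF p d(4) d(2) normal(3)]
  note f = form[OF p] lorentz_commute[of "Dv r p" "Du r p"]
  show "lorentz (Du (Du r) p) (N p) = \<mu> (fst p) * C p"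
    using X(1) unfolding shape[OF p] \<mu>_def
    by (simp add: lorentz_simps f algebra_simps)
  show "lorentz (Dv (Du r) p) (N p) = \<mu> (fst p) * H p"
    using X(2) unfolding shape[OF p] \<mu>_def
    by (simp add: lorentz_simps f algebra_simps)
  show "lorentz (Dv (Dv r) p) (N p) = \<mu> (fst p) * C p"
    using Y(2) unfolding shape[OF p] \<mu>_def
    by (simp add: lorentz_simps f algebra_simps)
qed

lemma gauss_formulas:
  assumes p: "p \<in> S"
  defines "w \<equiv> \<rho>' (fst p) / \<rho> (fst p)"
  shows "Du (Du r) p = w *\<^sub>R Du r p + (\<mu> (fst p) * C p) *\<^sub>R N p"
    "Dv (Du r) p = w *\<^sub>R Dv r p + (\<mu> (fst p) * H p) *\<^sub>R N p"
    "Dv (Dv r) p = w *\<^sub>R Du r p + (\<mu> (fst p) * C p) *\<^sub>R N p"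
proof -
  have "\<rho> (fst p) \<noteq> 0" using \<rho>_pos[OF fstS[OF p]] by simp
  then have w: "\<rho> (fst p) * \<rho>' (fst p) / (\<rho> (fst p))\<^sup>2 = w"
    unfolding w_def by (simp add: power2_eq_square)
  note e = expand[OF p, of "Du (Du r) p"] expand[OF p, of "Dv (Du r) p"] expand[OF p, of "Dv (Dv r) p"]
  note s = second_derivatives_tangential[OF p] second_derivatives_normal[OF p]
  show "Du (Du r) p = w *\<^sub>R Du r p + (\<mu> (fst p) * C p) *\<^sub>R N p"
    using e(1) unfolding s w by simp
  show "Dv (Du r) p = w *\<^sub>R Dv r p + (\<mu> (fst p) * H p) *\<^sub>R N p"
    using e(2) unfolding s minus_divide_left[symmetric] w by simp
  show "Dv (Dv r) p = w *\<^sub>R Du r p + (\<mu> (fst p) * C p) *\<^sub>R N p"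
    using e(3) unfolding s w by simp
qed

text \<open>
  Both \<open>\<langle>r\<^sub>u\<^sub>u, r\<^sub>v\<rangle> = 0\<close> and \<open>\<langle>r\<^sub>u\<^sub>v, r\<^sub>v\<rangle> = - \<rho> \<rho>'\<close> are differentiated, in the direction that
  makes the third derivative \<open>r\<^sub>u\<^sub>u\<^sub>v\<close> appear; eliminating it leaves a relation among second
  derivatives, which the Gauss formulas evaluate.
\<close>

lemma gauss_equation:
  assumes u: "u \<in> I"
  shows "\<rho> u * \<rho>'' u - (\<rho>' u)\<^sup>2 = (\<mu> u)\<^sup>2"
proof -
  obtain v where "v \<in> J" using J(3) by blast
  define p where "p = (u, v)"
  have p: "p \<in> S" "fst p = u" using u \<open>v \<in> J\<close> by (auto simp: p_def)
  note d = differentiable[OF p(1)]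
  have d1: "((\<lambda>u. - (\<rho> u * \<rho>' u)) has_real_derivative - (\<rho>' u * \<rho>' u + \<rho> u * \<rho>'' u)) (at (fst p))"
    unfolding p(2) using \<rho>_deriv[OF u] by (auto intro!: derivative_eq_intros)
  have 1: "lorentz (Du (Dv (Du r)) p) (Dv r p) + lorentz (Du (Du r) p) (Dv (Dv r) p) = 0"
    using Du_Dv_orthogonal(2)[OF p(1) d(5) d(4) second_derivatives_tangential(5)]
    unfolding mixed3[OF p(1)] by simp
  have 2: "lorentz (Du (Dv (Du r)) p) (Dv r p) + lorentz (Dv (Du r) p) (Dv (Du r) p)
      = - (\<rho>' u * \<rho>' u + \<rho> u * \<rho>'' u)"
    using Du_Dv_fst(1)[OF p(1) second_derivatives_tangential(3) d1]
    unfolding Du_Dv_lorentz[OF d(6) d(4)] mixed[OF p(1)] .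
  have w: "\<rho>' u / \<rho> u * (\<rho>' u / \<rho> u) * (\<rho> u)\<^sup>2 = (\<rho>' u)\<^sup>2"
    using \<rho>_pos[OF u] by (simp add: power2_eq_square)
  note i = form[OF p(1)] normal[OF p(1)] p(2)
    lorentz_commute[of "N p" "Du r p"] lorentz_commute[of "N p" "Dv r p"]
  have "lorentz (Du (Du r) p) (Dv (Dv r) p)
      = \<rho>' u / \<rho> u * (\<rho>' u / \<rho> u) * (\<rho> u)\<^sup>2 + \<mu> u * C p * (\<mu> u * C p)"
    unfolding gauss_formulas[OF p(1)] p(2) by (simp add: lorentz_simps i)
  then have 3: "lorentz (Du (Du r) p) (Dv (Dv r) p) = (\<rho>' u)\<^sup>2 + (\<mu> u)\<^sup>2 * (C p)\<^sup>2"
    unfolding w by (simp only: power2_eq_square mult_ac)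
  have "lorentz (Dv (Du r) p) (Dv (Du r) p)
      = - (\<rho>' u / \<rho> u * (\<rho>' u / \<rho> u) * (\<rho> u)\<^sup>2) + \<mu> u * H p * (\<mu> u * H p)"
    unfolding gauss_formulas[OF p(1)] p(2) by (simp add: lorentz_simps i)
  then have 4: "lorentz (Dv (Du r) p) (Dv (Du r) p) = - (\<rho>' u)\<^sup>2 + (\<mu> u)\<^sup>2 * (H p)\<^sup>2"
    unfolding w by (simp only: power2_eq_square mult_ac)
  show ?thesis
    using 1 2 unfolding 3 4 cosh_square_eq by (simp add: power2_eq_square algebra_simps)
qed

text \<open>
  The Codazzi equation is \<open>\<partial>\<^sub>v h\<^sub>1\<^sub>1 = \<partial>\<^sub>u h\<^sub>1\<^sub>2\<close>, that is \<open>2 a \<mu> sinh (2 a v) = \<mu>' sinh (2 a v)\<close>.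
  It is used on a single line \<open>v \<noteq> 0\<close>. There \<open>\<mu>\<close> is the smooth function \<open>h\<^sub>1\<^sub>2\<close> divided by a
  nonzero constant, which also supplies the differentiability of \<open>\<mu>\<close>.
\<close>

lemma codazzi_equation:
  assumes u: "u \<in> I"
  shows "(\<mu> has_real_derivative 2 * a * \<mu> u) (at u)"
proof -
  have "\<exists>v\<in>J. v \<noteq> 0"
    using J(1,3) not_open_singleton[of "0::real"] by (metis all_not_in_conv singletonI subsetI subset_singletonD)
  then obtain v where v: "v \<in> J" "v \<noteq> 0" by blast
  then have nz: "sinh (2*a* v) \<noteq> 0" using a by simp
  define h11 where "h11 q = lorentz (Du (Du r) q) (N q)" for q
  define h12 where "h12 q = lorentz (Dv (Du r) q) (N q)" for q
  define p where "p = (u, v)"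
  have p: "p \<in> S" "fst p = u" "snd p = v" using u v by (auto simp: p_def)
  note d = differentiable[OF p(1)]
  note t = second_derivatives_tangential[OF p(1)]
  have h: "h11 q = \<mu> (fst q) * C q" "h12 q = \<mu> (fst q) * H q" if "q \<in> S" for q
    unfolding h11_def h12_def using second_derivatives_normal[OF that] by blast+
  have "Dv h11 p = lorentz (Du (Dv (Du r)) p) (N p) - l u * H p * (\<rho> u * \<rho>' u)"
    unfolding h11_def[abs_def] Du_Dv_lorentz[OF d(5) d(2)] mixed3[OF p(1)] shape[OF p(1)]
    by (simp add: lorentz_simps t p(2))
  moreover have "Du h12 p = lorentz (Du (Dv (Du r)) p) (N p) - l u * H p * (\<rho> u * \<rho>' u)"
    unfolding h12_def[abs_def] Du_Dv_lorentz[OF d(6) d(2)] shape[OF p(1)]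
    by (simp add: lorentz_simps t p(2))
  ultimately have eq: "Dv h11 p = Du h12 p" by simp
  have h12_deriv: "((\<lambda>x. h12 (x, v)) has_real_derivative Du h12 p) (at u)"
    unfolding p_def by (rule DERIV_slices)
      (use Du_Dv_lorentz(3)[OF d(6) d(2)] in \<open>simp add: h12_def[abs_def] p_def\<close>)
  have "((\<lambda>y. h11 (u, y)) has_real_derivative Dv h11 p) (at v)"
    unfolding p_def by (rule DERIV_slices)
      (use Du_Dv_lorentz(3)[OF d(5) d(2)] in \<open>simp add: h11_def[abs_def] p_def\<close>)
  then have "((\<lambda>y. \<mu> u * cosh (2*a*y)) has_real_derivative Dv h11 p) (at v)"
    by (rule has_field_derivative_transform_within_open[OF _ J(1) v(1)]) (use h(1) u in simp)
  moreover have "((\<lambda>y. \<mu> u * cosh (2*a*y)) has_real_derivative \<mu> u * (2*a * sinh (2*a* v))) (at v)"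
    by (auto intro!: derivative_eq_intros)
  ultimately have "Dv h11 p = \<mu> u * (2*a * sinh (2*a* v))"
    by (rule DERIV_unique)
  then have "((\<lambda>x. h12 (x, v) / sinh (2*a* v)) has_real_derivative 2 * a * \<mu> u) (at u)"
    using DERIV_cdivide[OF h12_deriv, of "sinh (2*a* v)"] nz eq by (simp add: mult_ac)
  then show ?thesis
    by (rule has_field_derivative_transform_within_open[OF _ I(1) u]) (use h(2) v nz in simp)
qed

lemma \<mu>_exponential: "\<exists>m. \<forall>u\<in>I. \<mu> u = m * exp (2*a*u)"
proof -
  obtain u0 where u0: "u0 \<in> I" using I(3) by blast
  have "\<mu> u * exp (- (2*a*u)) = \<mu> u0 * exp (- (2*a*u0))" if "u \<in> I" for u
    by (rule DERIV_zero_imp_const[OF I(2) _ that u0])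
       (auto intro!: derivative_eq_intros codazzi_equation)
  then have "\<mu> u = \<mu> u0 * exp (- (2*a*u0)) * exp (2*a*u)" if "u \<in> I" for u
    using that by (simp add: exp_minus field_simps)
  then show ?thesis by blast
qed

end

section \<open>Congruence with a model surface\<close>

context twisted_minimal
begin

text \<open>
  The Codazzi equation makes \<open>\<mu>\<close> a multiple \<open>m\<close> of \<open>exp (2 a u)\<close>. The factor \<open>exp (2 a u)\<close> is
  log-linear, so dividing \<open>\<rho>\<close> by it does not change \<open>(log \<rho>)''\<close>, and the Gauss equation turns
  into the Liouville equation for \<open>\<rho> exp (- 2 a u) / \<bar>m\<bar>\<close>.
\<close>

lemma conformal_factor_solution:
  assumes u1: "u1 \<in> I" "l u1 \<noteq> 0"
  shows "\<exists>m A B. m \<noteq> 0 \<and> A > 0 \<and> B > 0 \<and>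
    (\<forall>u\<in>I. \<mu> u = m * exp (2*a*u) \<and> \<rho> u = \<bar>m\<bar> * conformal_factor a A B u)"
proof -
  obtain m where m: "\<And>u. u \<in> I \<Longrightarrow> \<mu> u = m * exp (2*a*u)"
    using \<mu>_exponential by blast
  have "m \<noteq> 0"
    using m[OF u1(1)] u1(2) \<rho>_pos[OF u1(1)] by (auto simp: \<mu>_def)
  define y where "y u = \<rho> u * exp (- (2*a*u)) / \<bar>m\<bar>" for u
  define y' where "y' u = (\<rho>' u - 2*a * \<rho> u) * exp (- (2*a*u)) / \<bar>m\<bar>" for u
  define y'' where "y'' u = (\<rho>'' u - 4*a * \<rho>' u + 4*a\<^sup>2 * \<rho> u) * exp (- (2*a*u)) / \<bar>m\<bar>" for u
  have "\<exists>A B. A > 0 \<and> B > 0 \<and> (\<forall>u\<in>I. y u = cosh (B * u + ln A) / B)"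
  proof (rule liouville_ode_solution[OF I(2,3)])
    fix u assume u: "u \<in> I"
    show "(y has_real_derivative y' u) (at u)"
      unfolding y_def[abs_def] y'_def using \<open>m \<noteq> 0\<close>
      by (auto intro!: derivative_eq_intros \<rho>_deriv(1)[OF u] simp: field_simps)
    show "(y' has_real_derivative y'' u) (at u)"
      unfolding y'_def[abs_def] y''_def using \<open>m \<noteq> 0\<close>
      by (auto intro!: derivative_eq_intros \<rho>_deriv[OF u] simp: field_simps power2_eq_square)
    show "y u > 0"
      unfolding y_def using \<rho>_pos[OF u] \<open>m \<noteq> 0\<close> by simp
    have "y u * y'' u - (y' u)\<^sup>2 = (\<rho> u * \<rho>'' u - (\<rho>' u)\<^sup>2) * (exp (- (2*a*u)) / \<bar>m\<bar>)\<^sup>2"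
      unfolding y_def y'_def y''_def times_divide_eq_right[symmetric] by algebra
    also have "\<dots> = (m * (exp (2*a*u) * exp (- (2*a*u))) / \<bar>m\<bar>)\<^sup>2"
      unfolding gauss_equation[OF u] m[OF u] by (simp add: power_mult_distrib power_divide)
    also have "\<dots> = 1"
      using \<open>m \<noteq> 0\<close> unfolding exp_minus_inverse by (simp add: power_divide)
    finally show "y u * y'' u - (y' u)\<^sup>2 = 1" .
  qed
  then obtain A B where AB: "A > 0" "B > 0" "\<And>u. u \<in> I \<Longrightarrow> y u = cosh (B * u + ln A) / B"
    by blast
  have "\<rho> u = \<bar>m\<bar> * conformal_factor a A B u" if "u \<in> I" for u
  proof -
    have "\<rho> u = \<bar>m\<bar> * (exp (2*a*u) * y u)"
      unfolding y_def using \<open>m \<noteq> 0\<close> by (simp add: exp_minus field_simps)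
    then show ?thesis unfolding AB(3)[OF that] conformal_factor_def by simp
  qed
  then show ?thesis using \<open>m \<noteq> 0\<close> AB(1,2) m by blast
qed

text \<open>
  After scaling by \<open>1 / m\<close> the surface has the structure equations of the model, with the frame
  \<open>r\<^sub>u\<close>, \<open>r\<^sub>v\<close> normalized by \<open>k = sgn m / \<rho>\<close>. The sign of \<open>m\<close> has to enter the scaling, because the
  factor \<open>exp (2 a u)\<close> in the second fundamental form of the model is positive. It remains to match
  the logarithmic derivative of \<open>\<rho>\<close> with the connection form and \<open>k \<mu>\<close> with the curvature terms.
\<close>

lemma similar_to_model:
  assumes u1: "u1 \<in> I" "l u1 \<noteq> 0"
  shows "\<exists>A B m L b. A > 0 \<and> B > 0 \<and> m \<noteq> 0 \<and> linear L \<and>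
    (\<forall>x y. lorentz (L x) (L y) = lorentz x y) \<and> (\<forall>p\<in>S. model a A B p = L ((1 / m) *\<^sub>R r p) + b)"
proof -
  obtain m A B where m: "m \<noteq> 0" and AB: "A > 0" "B > 0"
    and \<mu>: "\<And>u. u \<in> I \<Longrightarrow> \<mu> u = m * exp (2*a*u)"
    and \<rho>: "\<And>u. u \<in> I \<Longrightarrow> \<rho> u = \<bar>m\<bar> * conformal_factor a A B u"
    using conformal_factor_solution[OF u1] by blast
  interpret M: twisted_model a A B by unfold_locales (use AB in auto)
  define \<sigma> where "\<sigma> = sgn m"
  have \<sigma>: "\<sigma> * \<sigma> = 1" "\<sigma> * m = \<bar>m\<bar>" using m by (auto simp: \<sigma>_def sgn_if abs_if)
  define k where "k u = \<sigma> / \<rho> u" for u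
  have log_deriv: "\<rho>' (fst p) / \<rho> (fst p) = 2*a + B * M.T p" if p: "p \<in> S" for p
  proof -
    define u where "u = fst p"
    have u: "u \<in> I" using fstS[OF p] by (simp add: u_def)
    have "((\<lambda>u. \<bar>m\<bar> * conformal_factor a A B u) has_real_derivative
        \<bar>m\<bar> * (conformal_factor a A B u * (2*a + B * tanh (B * u + ln A)))) (at u)"
      unfolding conformal_factor_def[abs_def] using cosh_neq_0[of "B * u + ln A"] AB
      by (auto intro!: derivative_eq_intros simp: tanh_def field_simps)
    then have "(\<rho> has_real_derivative
        \<bar>m\<bar> * (conformal_factor a A B u * (2*a + B * tanh (B * u + ln A)))) (at u)"
      by (rule has_field_derivative_transform_within_open[OF _ I(1) u]) (use \<rho> in simp)
    then have "\<rho>' u = \<bar>m\<bar> * (conformal_factor a A B u * (2*a + B * tanh (B * u + ln A)))"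
      using DERIV_unique \<rho>_deriv(1)[OF u] by blast
    then have "\<rho>' u = \<rho> u * (2*a + B * tanh (B * u + ln A))"
      using \<rho>[OF u] by simp
    then show ?thesis
      using \<rho>_pos[OF u] unfolding M.T_def u_def by simp
  qed
  have curv: "B * M.Z p = k (fst p) * \<mu> (fst p)" if p: "p \<in> S" for p
  proof -
    have "k (fst p) * \<mu> (fst p) = (\<sigma> * m) * exp (2*a * fst p) / \<rho> (fst p)"
      unfolding k_def \<mu>[OF fstS[OF p]] by simp
    also have "\<dots> = B * M.Z p"
      unfolding \<sigma> \<rho>[OF fstS[OF p]] conformal_factor_def M.Z_def
      using m AB cosh_neq_0[of "B * fst p + ln A"] by (simp add: field_simps)
    finally show ?thesis by simp
  qed
  have frame: "adapted_frame S M.conn M.curv_u M.curv_v (\<lambda>p. conformal_factor a A B (fst p))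
      (\<lambda>p. (1 / m) *\<^sub>R r p) (\<lambda>p. k (fst p) *\<^sub>R Du r p) (\<lambda>p. k (fst p) *\<^sub>R Dv r p) N"
    unfolding adapted_frame_def
  proof (intro ballI conjI)
    fix p assume p: "p \<in> S"
    note u = fstS[OF p]
    have \<rho>0: "\<rho> (fst p) \<noteq> 0" using \<rho>_pos[OF u] by simp
    note d = differentiable[OF p]
    define w where "w = \<rho>' (fst p) / \<rho> (fst p)"
    have w: "2*a + B * M.T p = w" using log_deriv[OF p] by (simp add: w_def)
    note gf = gauss_formulas[OF p, folded w_def] and cv = curv[OF p]
    show "orthonormal_frame (k (fst p) *\<^sub>R Du r p) (k (fst p) *\<^sub>R Dv r p) (N p)"
      unfolding k_def by (rule orthonormal[OF p]) (use \<sigma>(1) in \<open>simp add: power2_eq_square\<close>)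
    have k_deriv: "((\<lambda>q. k (fst q)) has_derivative (\<lambda>h. - w * k (fst p) * fst h)) (at p)"
      by (rule has_derivative_fst_snd_comp(1))
        (use \<rho>_deriv(1)[OF u] \<rho>0 in \<open>auto intro!: derivative_eq_intros simp: k_def[abs_def] w_def field_simps\<close>)
    have "conformal_factor a A B (fst p) * k (fst p) = 1 / m"
    proof -
      have "conformal_factor a A B (fst p) * k (fst p) = \<sigma> / \<bar>m\<bar>"
        unfolding k_def \<rho>[OF u] using M.conformal_factor_pos[of "fst p"] by simp
      also have "\<dots> = 1 / m" using m by (simp add: \<sigma>_def sgn_if abs_if)
      finally show ?thesis .
    qed
    then have coframe: "(conformal_factor a A B (fst p) * x) * k (fst p) = x / m" for x
      by (metis mult.assoc mult.commute mult.right_neutral times_divide_eq_right)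
    show "((\<lambda>p. (1 / m) *\<^sub>R r p) has_derivative
        (\<lambda>h. (conformal_factor a A B (fst p) * fst h) *\<^sub>R k (fst p) *\<^sub>R Du r p
          + (conformal_factor a A B (fst p) * snd h) *\<^sub>R k (fst p) *\<^sub>R Dv r p)) (at p)"
      by (rule has_derivative_eq_rhs[OF has_derivative_scaleR_right[OF has_derivative_Du_Dv[OF d(1)]]])
        (simp add: coframe scaleR_add_right)
    show "((\<lambda>p. k (fst p) *\<^sub>R Du r p) has_derivative
        (\<lambda>h. M.conn p h *\<^sub>R k (fst p) *\<^sub>R Dv r p + M.curv_u p h *\<^sub>R N p)) (at p)"
      apply (rule has_derivative_eq_rhs[OF has_derivative_scaleR[OF k_deriv has_derivative_Du_Dv[OF d(3)]]])
      apply (rule ext)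
      apply (simp only: M.conn_def M.curv_u_def M.CC_def M.SS_def w cv gf)
      apply (simp add: algebra_simps)
      done
    show "((\<lambda>p. k (fst p) *\<^sub>R Dv r p) has_derivative
        (\<lambda>h. M.conn p h *\<^sub>R k (fst p) *\<^sub>R Du r p + M.curv_v p h *\<^sub>R N p)) (at p)"
      apply (rule has_derivative_eq_rhs[OF has_derivative_scaleR[OF k_deriv has_derivative_Du_Dv[OF d(4)]]])
      apply (rule ext)
      apply (simp only: M.conn_def M.curv_v_def M.CC_def M.SS_def w cv gf mixed[OF p])
      apply (simp add: algebra_simps)
      done
    have "k (fst p) * \<mu> (fst p) * k (fst p) = (\<sigma> * \<sigma>) * l (fst p)"
      unfolding k_def \<mu>_def using \<rho>0 by (simp add: power2_eq_square)
    then have lk: "l (fst p) = k (fst p) * \<mu> (fst p) * k (fst p)"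
      using \<sigma>(1) by simp
    show "(N has_derivative
        (\<lambda>h. M.curv_v p h *\<^sub>R k (fst p) *\<^sub>R Dv r p - M.curv_u p h *\<^sub>R k (fst p) *\<^sub>R Du r p)) (at p)"
      apply (rule has_derivative_eq_rhs[OF has_derivative_Du_Dv[OF d(2)]])
      apply (rule ext)
      apply (simp only: M.curv_v_def M.curv_u_def M.CC_def M.SS_def cv shape[OF p] lk)
      apply (simp add: algebra_simps)
      done
  qed
  have frame': "adapted_frame S M.conn M.curv_u M.curv_v (\<lambda>p. conformal_factor a A B (fst p)) (model a A B) M.F1 M.F2 M.F3"
    using M.adapted_frame_model unfolding adapted_frame_def by blast
  have "convex S" using I(2) J(2) by (intro convex_Times is_interval_convex)
  from adapted_frame_rigidity[OF this frame frame'] show ?thesis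
    using AB m by blast
qed

end

lemma twist_matrix:
  "(boost (- t) ** diag2 x y ** boost t)$1$1 = x * (cosh t)\<^sup>2 - y * (sinh t)\<^sup>2"
  "(boost (- t) ** diag2 x y ** boost t)$1$2 = (x - y) * (sinh t * cosh t)"
  "(boost (- t) ** diag2 x y ** boost t)$2$1 = - (x - y) * (sinh t * cosh t)"
  "(boost (- t) ** diag2 x y ** boost t)$2$2 = y * (cosh t)\<^sup>2 - x * (sinh t)\<^sup>2"
  by (simp_all add: boost_def diag2_def matrix_matrix_mult_def sum_2 power2_eq_square algebra_simps)

text \<open>
  The mean curvature is half the trace of the Weingarten endomorphism, so its vanishing leaves one
  function \<open>l\<close>; the double angle formulas then bring the twist condition into the form \<open>shape\<close>.
\<close>

lemma twisted_minimal_of_intrinsic_rotational: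
  assumes "a \<noteq> 0"
    and rot: "intrinsic_rotational 1 (-1) \<rho> r I J"
    and un: "unit_normal_field r (I \<times> J) N"
    and tw: "has_twist r N I J (\<lambda>v. a * v)"
    and H0: "\<forall>p\<in>I \<times> J. mean_curvature r N p = 0"
  shows "\<exists>l. twisted_minimal \<rho> I J r N a l"
proof -
  have tm: "tangent_map r p (1,0) = Du r p" "tangent_map r p (0,1) = Dv r p" for p
    by (simp_all add: tangent_map_def Du_def Dv_def)
  have ff: "first_form r p x y = (\<rho> (fst p))\<^sup>2 * (fst x * fst y - snd x * snd y)" if "p \<in> I \<times> J" for p x y
  proof -
    have "has_first_form r (I \<times> J) 1 (-1) (\<lambda>u v. (\<rho> u)\<^sup>2)"
      using rot unfolding intrinsic_rotational_def by blast
    then show ?thesis using that unfolding has_first_form_def by (cases p; cases x; cases y) auto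
  qed
  interpret isothermal_surface \<rho> I J r N
  proof
    show "open I" "is_interval I" "I \<noteq> {}" "open J" "is_interval J" "J \<noteq> {}"
      "smooth_on (I \<times> J) r" "smooth_on I \<rho>" "\<And>u. u \<in> I \<Longrightarrow> 0 < \<rho> u"
      using rot unfolding intrinsic_rotational_def timelike_surface_def by blast+
    show "smooth_on (I \<times> J) N" using un unfolding unit_normal_field_def by blast
    fix p assume p: "p \<in> I \<times> J"
    show "lorentz (Du r p) (Du r p) = (\<rho> (fst p))\<^sup>2" "lorentz (Dv r p) (Dv r p) = - (\<rho> (fst p))\<^sup>2"
      "lorentz (Du r p) (Dv r p) = 0"
      using ff[OF p, of "(1,0)" "(1,0)"] ff[OF p, of "(0,1)" "(0,1)"] ff[OF p, of "(1,0)" "(0,1)"]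
      by (simp_all add: first_form_def tm)
    have "lorentz (N p) (N p) = 1" "\<And>x. lorentz (N p) (tangent_map r p x) = 0"
      using un p unfolding unit_normal_field_def by blast+
    from this(1) this(2)[of "(1,0)"] this(2)[of "(0,1)"]
    show "lorentz (N p) (N p) = 1" "lorentz (Du r p) (N p) = 0" "lorentz (Dv r p) (N p) = 0"
      by (simp_all add: tm lorentz_commute)
  qed
  obtain l1 l2 where W: "\<And>p. p \<in> S \<Longrightarrow> weingarten_matrix r N p
      (boost (- (a * snd p)) ** diag2 (l1 (fst p)) (l2 (fst p)) ** boost (a * snd p))"
    using tw unfolding has_twist_def by fastforce
  have sum0: "l2 (fst p) = - l1 (fst p)" if p: "p \<in> S" for p
  proof -
    have tr: "k1 + k2 = l1 (fst p) + l2 (fst p)" if "principal_curvatures r N p k1 k2" for k1 k2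
      using principal_curvatures_sum[OF p W[OF p] that]
      unfolding twist_matrix cosh_square_eq by (simp add: algebra_simps)
    have "\<exists>k1 k2. principal_curvatures r N p k1 k2"
      using tw p unfolding has_twist_def by blast
    then obtain k1 k2 where "principal_curvatures r N p k1 k2" by blast
    then have "mean_curvature r N p = (l1 (fst p) + l2 (fst p)) / 2"
      unfolding mean_curvature_def by (intro the_equality) (metis tr)+
    then show ?thesis using H0 p by auto
  qed
  have "twisted_minimal \<rho> I J r N a l1"
  proof
    fix p assume p: "p \<in> I \<times> J"
    have C: "(cosh (a * snd p))\<^sup>2 + (sinh (a * snd p))\<^sup>2 = cosh (2*a * snd p)"
      using cosh_double[of "a * snd p"] by (simp add: mult.assoc)
    have H: "2 * (sinh (a * snd p) * cosh (a * snd p)) = sinh (2*a * snd p)"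
      using sinh_double[of "a * snd p"] by (simp add: mult.assoc)
    have M: "l1 (fst p) * (cosh (a * snd p))\<^sup>2 - l2 (fst p) * (sinh (a * snd p))\<^sup>2 = l1 (fst p) * cosh (2*a * snd p)"
      "(l1 (fst p) - l2 (fst p)) * (sinh (a * snd p) * cosh (a * snd p)) = l1 (fst p) * sinh (2*a * snd p)"
      "- (l1 (fst p) - l2 (fst p)) * (sinh (a * snd p) * cosh (a * snd p)) = - (l1 (fst p) * sinh (2*a * snd p))"
      "l2 (fst p) * (cosh (a * snd p))\<^sup>2 - l1 (fst p) * (sinh (a * snd p))\<^sup>2 = - (l1 (fst p) * cosh (2*a * snd p))"
      unfolding sum0[OF p] C[symmetric] H[symmetric] by (simp_all add: algebra_simps)
    have "- Du N p = (l1 (fst p) * cosh (2*a * snd p)) *\<^sub>R Du r p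
        + (- (l1 (fst p) * sinh (2*a * snd p))) *\<^sub>R Dv r p"
      "- Dv N p = (l1 (fst p) * sinh (2*a * snd p)) *\<^sub>R Du r p
        + (- (l1 (fst p) * cosh (2*a * snd p))) *\<^sub>R Dv r p"
      using W[OF p] unfolding weingarten_matrix_def twist_matrix M weingarten_eq[OF p] tm by simp_all
    from this[THEN arg_cong[of _ _ uminus]]
    show "Du N p = - l1 (fst p) *\<^sub>R (cosh (2*a * snd p) *\<^sub>R Du r p - sinh (2*a * snd p) *\<^sub>R Dv r p)"
      "Dv N p = - l1 (fst p) *\<^sub>R (sinh (2*a * snd p) *\<^sub>R Du r p - cosh (2*a * snd p) *\<^sub>R Dv r p)"
      by (simp_all add: algebra_simps)
  qed (rule assms(1))
  then show ?thesis by blast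
qed

lemma (in twisted_minimal) umbilic_if_shape_zero:
  assumes "p \<in> S" "l (fst p) = 0"
  shows "umbilic r N p"
proof -
  have w: "weingarten r N p x = 0" for x
    unfolding weingarten_eq[OF assms(1)] shape[OF assms(1)] by (simp add: assms(2))
  have "(1::real, 0::real) \<notin> span {(0, 1)}"
    by (auto simp: span_singleton)
  then have "independent {(1::real, 0::real), (0, 1)}"
    by (simp add: independent_insert prod_eq_iff)
  moreover have "(1::real, 0::real) \<noteq> (0, 1)" by simp
  ultimately show ?thesis
    unfolding umbilic_def principal_curvatures_def w by (metis scaleR_zero_left)
qed

text \<open>
  The homothety is taken about the origin, so the translation is scaled by \<open>m\<close> beforehand.
\<close>

lemma parametrized_if_similar:
  assumes "m \<noteq> 0" "linear L" "\<And>x y. lorentz (L x) (L y) = lorentz x y"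
    and "\<And>p. p \<in> S \<Longrightarrow> X p = L ((1 / m) *\<^sub>R r p) + b"
  shows "parametrized_up_to_similarity (r ` S) X S"
  unfolding parametrized_up_to_similarity_def
proof (intro exI conjI)
  show "lorentz_isometry (\<lambda>x. L x + m *\<^sub>R b)"
    unfolding lorentz_isometry_def using assms(2,3) by blast
  show "homothety (\<lambda>x. 0 + (1 / m) *\<^sub>R (x - 0))"
    unfolding homothety_def by (rule exI[of _ 0], rule exI[of _ "1 / m"]) (use assms(1) in simp)
  have "(1 / m) *\<^sub>R (L (r p) + m *\<^sub>R b) = X p" if "p \<in> S" for p
    using assms(1) by (simp add: assms(4)[OF that] linear_scale[OF assms(2)] scaleR_add_right)
  then show "((\<lambda>x. 0 + (1 / m) *\<^sub>R (x - 0)) \<circ> (\<lambda>x. L x + m *\<^sub>R b)) ` r ` S = X ` S"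
    by (simp add: image_image)
qed

theorem theorem3p8:
  fixes a :: real and \<rho> :: "real \<Rightarrow> real" and I J :: "real set"
    and r N :: "real \<times> real \<Rightarrow> real^3" and \<Sigma> :: "(real^3) set"
  assumes "a \<noteq> 0"
    and "\<Sigma> = r ` (I \<times> J)"
    and "intrinsic_rotational 1 (-1) \<rho> r I J"
    and "unit_normal_field r (I \<times> J) N"
    and "has_twist r N I J (\<lambda>v. a * v)"
    and "\<forall>p\<in>I \<times> J. mean_curvature r N p = 0"
    and "\<not> (\<exists>U. open U \<and> U \<noteq> {} \<and> U \<subseteq> I \<times> J \<and> (\<forall>p\<in>U. umbilic r N p))"
  shows "\<exists>A B. A > 0 \<and> B > 0 \<and>
    (B \<noteq> 2 * a \<and> B \<noteq> - 2 * a \<longrightarrow>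
      (let X = (\<lambda>(u, v). vector
        [exp (2*a*u) * cosh (2*a* v) / (2*a*B),
         exp ((2*a - B)*u) *
           ((2*a + B) * cosh ((2*a - B)* v) - A\<^sup>2 * (2*a - B) * exp (2*B*u) * cosh ((2*a + B)* v))
           / (2*A*B*(4*a\<^sup>2 - B\<^sup>2)),
         - (exp ((2*a - B)*u) *
           (A\<^sup>2 * (2*a - B) * exp (2*B*u) * sinh ((2*a + B)* v) + (2*a + B) * sinh ((2*a - B)* v))
           / (2*A*B*(4*a\<^sup>2 - B\<^sup>2)))])
       in parametrized_up_to_similarity \<Sigma> X (I \<times> J) \<and>
          has_first_form X UNIV 1 (-1)
            (\<lambda>u v. exp ((4*a - 2*B)*u) * (A\<^sup>2 * exp (2*B*u) + 1)\<^sup>2 / (4 * A\<^sup>2 * B\<^sup>2)) \<and>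
          {p. immersion_at X p} = UNIV)) \<and>
    (B = 2 * a \<longrightarrow>
      (let X = (\<lambda>(u, v). vector
        [exp (2*a*u) * cosh (2*a* v) / (4*a\<^sup>2),
         (4*a*u - A\<^sup>2 * exp (4*a*u) * cosh (4*a* v)) / (16*a\<^sup>2*A),
         - ((A\<^sup>2 * exp (4*a*u) * sinh (4*a* v) + 4*a* v) / (16*a\<^sup>2*A))])
       in parametrized_up_to_similarity \<Sigma> X (I \<times> J) \<and>
          has_first_form X UNIV 1 (-1)
            (\<lambda>u v. (A\<^sup>2 * exp (4*a*u) + 1)\<^sup>2 / (16 * a\<^sup>2 * A\<^sup>2)) \<and>
          {p. immersion_at X p} = UNIV)) \<and>
    (B = - 2 * a \<longrightarrow>
      (let X = (\<lambda>(u, v). vector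
        [- (exp (2*a*u) * cosh (2*a* v) / (4*a\<^sup>2)),
         (4*a*A\<^sup>2*u - exp (4*a*u) * cosh (4*a* v)) / (16*a\<^sup>2*A),
         (4*a*A\<^sup>2* v + exp (4*a*u) * sinh (4*a* v)) / (16*a\<^sup>2*A)])
       in parametrized_up_to_similarity \<Sigma> X (I \<times> J) \<and>
          has_first_form X UNIV 1 (-1)
            (\<lambda>u v. (A\<^sup>2 + exp (4*a*u))\<^sup>2 / (16 * a\<^sup>2 * A\<^sup>2)) \<and>
          {p. immersion_at X p} = UNIV))"
proof -
  obtain l where "twisted_minimal \<rho> I J r N a l"
    using twisted_minimal_of_intrinsic_rotational[OF assms(1,3-6)] by blast
  then interpret twisted_minimal \<rho> I J r N a l .
  \<comment> \<open>If \<open>l\<close> vanished identically, the whole surface would be umbilic.\<close>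
  have "\<exists>u\<in>I. l u \<noteq> 0"
  proof (rule ccontr)
    assume "\<not> (\<exists>u\<in>I. l u \<noteq> 0)"
    then have "\<forall>p\<in>S. umbilic r N p" using umbilic_if_shape_zero by auto
    moreover have "S \<noteq> {}" using I(3) J(3) by auto
    ultimately show False using assms(7) openS by blast
  qed
  then obtain u where u: "u \<in> I" "l u \<noteq> 0" by blast
  obtain A B m L b where AB: "A > 0" "B > 0" and m: "m \<noteq> 0"
    and L: "linear L" "\<forall>x y. lorentz (L x) (L y) = lorentz x y"
    and X: "\<forall>p\<in>S. model a A B p = L ((1 / m) *\<^sub>R r p) + b"
    using similar_to_model[OF u] by (elim exE conjE) (rule that)
  interpret M: twisted_model a A B by unfold_locales (use AB in auto)
  have par: "parametrized_up_to_similarity \<Sigma> (model a A B) (I \<times> J)"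
    unfolding assms(2) by (rule parametrized_if_similar[OF m L(1) L(2)[rule_format] X[rule_format]])
  have imm: "{p. immersion_at (model a A B) p} = UNIV"
    using M.model_immersion by blast
  have ff: "has_first_form (model a A B) UNIV 1 (-1) g"
    if "\<And>u v. g u v = exp ((4*a - 2*B)*u) * (A\<^sup>2 * exp (2*B*u) + 1)\<^sup>2 / (4 * A\<^sup>2 * B\<^sup>2)" for g
    unfolding has_first_form_def
    using conformal_factor_square[of A B a] AB by (auto simp: M.model_first_form that)
  show ?thesis
  proof (rule exI[of _ A], rule exI[of _ B], intro conjI impI AB)
    assume "B \<noteq> 2 * a \<and> B \<noteq> - 2 * a"
    then have B: "B \<noteq> 2 * a" "B \<noteq> - 2 * a" by auto
    show "let X = (\<lambda>(u, v). vector
        [exp (2*a*u) * cosh (2*a* v) / (2*a*B),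
         exp ((2*a - B)*u) *
           ((2*a + B) * cosh ((2*a - B)* v) - A\<^sup>2 * (2*a - B) * exp (2*B*u) * cosh ((2*a + B)* v))
           / (2*A*B*(4*a\<^sup>2 - B\<^sup>2)),
         - (exp ((2*a - B)*u) *
           (A\<^sup>2 * (2*a - B) * exp (2*B*u) * sinh ((2*a + B)* v) + (2*a + B) * sinh ((2*a - B)* v))
           / (2*A*B*(4*a\<^sup>2 - B\<^sup>2)))])
       in parametrized_up_to_similarity \<Sigma> X (I \<times> J) \<and>
          has_first_form X UNIV 1 (-1)
            (\<lambda>u v. exp ((4*a - 2*B)*u) * (A\<^sup>2 * exp (2*B*u) + 1)\<^sup>2 / (4 * A\<^sup>2 * B\<^sup>2)) \<and>
          {p. immersion_at X p} = UNIV"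
      unfolding Let_def
      using par ff[OF refl] imm AB unfolding model_eq_generic[OF less_imp_neq[OF AB(1), symmetric]
          less_imp_neq[OF AB(2), symmetric] assms(1) B] by blast
  next
    assume B: "B = 2 * a"
    have "exp ((4*a - 2*B)*u) * (A\<^sup>2 * exp (2*B*u) + 1)\<^sup>2 / (4 * A\<^sup>2 * B\<^sup>2)
        = (A\<^sup>2 * exp (4*a*u) + 1)\<^sup>2 / (16 * a\<^sup>2 * A\<^sup>2)" for u
      by (simp add: B power_mult_distrib mult_ac)
    note ff' = ff[OF this[symmetric]]
    show "let X = (\<lambda>(u, v). vector
        [exp (2*a*u) * cosh (2*a* v) / (4*a\<^sup>2),
         (4*a*u - A\<^sup>2 * exp (4*a*u) * cosh (4*a* v)) / (16*a\<^sup>2*A),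
         - ((A\<^sup>2 * exp (4*a*u) * sinh (4*a* v) + 4*a* v) / (16*a\<^sup>2*A))])
       in parametrized_up_to_similarity \<Sigma> X (I \<times> J) \<and>
          has_first_form X UNIV 1 (-1)
            (\<lambda>u v. (A\<^sup>2 * exp (4*a*u) + 1)\<^sup>2 / (16 * a\<^sup>2 * A\<^sup>2)) \<and>
          {p. immersion_at X p} = UNIV"
      unfolding Let_def
      using par ff' imm unfolding B model_eq_plus[OF assms(1)] by blast
  next
    assume B: "B = - 2 * a"
    have "exp ((4*a - 2*B)*u) * (A\<^sup>2 * exp (2*B*u) + 1)\<^sup>2 / (4 * A\<^sup>2 * B\<^sup>2)
        = (A\<^sup>2 + exp (4*a*u))\<^sup>2 / (16 * a\<^sup>2 * A\<^sup>2)" for u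
    proof -
      have "exp ((4*a - 2*B)*u) = (exp (4*a*u))\<^sup>2"
        by (simp add: B exp_double[symmetric] algebra_simps)
      moreover have "exp (2*B*u) = 1 / exp (4*a*u)"
        by (simp add: B exp_minus[symmetric] divide_inverse)
      ultimately show ?thesis
        by (simp add: B power_mult_distrib[symmetric] distrib_left mult_ac)
    qed
    note ff' = ff[OF this[symmetric]]
    show "let X = (\<lambda>(u, v). vector
        [- (exp (2*a*u) * cosh (2*a* v) / (4*a\<^sup>2)),
         (4*a*A\<^sup>2*u - exp (4*a*u) * cosh (4*a* v)) / (16*a\<^sup>2*A),
         (4*a*A\<^sup>2* v + exp (4*a*u) * sinh (4*a* v)) / (16*a\<^sup>2*A)])
       in parametrized_up_to_similarity \<Sigma> X (I \<times> J) \<and>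
          has_first_form X UNIV 1 (-1)
            (\<lambda>u v. (A\<^sup>2 + exp (4*a*u))\<^sup>2 / (16 * a\<^sup>2 * A\<^sup>2)) \<and>
          {p. immersion_at X p} = UNIV"
      unfolding Let_def
      using par ff' imm unfolding B model_eq_minus[OF assms(1) less_imp_neq[OF AB(1), symmetric]] by blast
  qed
qed

end
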